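(* Let $k$ be a field, $A$ a $k$-algebra, $I$ an ideal of $A$ and $S$ a multiplicative subset of $A$. Then $(\sqrt[s]{I})_S=\sqrt[s]{I_S}$ as ideals of $A_S$.
   Context: All rings are commutative and unital. $A_S=S^{-1}A$, and for an ideal $J$ of $A$, $J_S=S^{-1}J=JA_S$. The homogeneous signature $\mathcal H$ of $k$ is the set of all non-zero homogeneous polynomials $P(\bar X,Y)$ over $k$ in finitely many variables $\bar X=(X_1,\ldots,X_n)$ and a distinguished variable $Y$ such that for all $\bar a\in k^n$ and $b\in k$, $P(\bar a,b)=0$ implies $b=0$. An ideal $I$ of a $k$-algebra $A$ is special if for all $P(\bar X,Y)\in\mathcal H$ and $\bar a,b$ from $A$ such that $P(\bar a,b)\in I$, we have $b\in I$. The special radical $\sqrt[s]{I}$ of an ideal $I$ of a $k$-algebra $A$ is the intersection of all special prime ideals of $A$ containing $I$ (equal to $A$ if there are none). *)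

theory Defs
  imports "HOL-Algebra.Module" "HOL-Algebra.Ideal" "HOL-Algebra.Indexed_Polynomials"
begin

section \<open>Polynomials over \<open>k\<close> evaluated in a \<open>k\<close>-algebra\<close>

text \<open>
  A polynomial is an element of the library's set of indexed polynomials: a finitely supported map
  from monomials (multisets of variable indices) to coefficients. We use the index set
  \<open>{0, \<dots>, n}\<close>: index \<open>0\<close> is the distinguished variable \<open>Y\<close>, and index \<open>i\<close> with
  \<open>1 \<le> i \<le> n\<close> is \<open>X\<^sub>i\<close>. Accordingly \<open>a(0 := b)\<close> is the point \<open>(a\<^sub>1, \<dots>, a\<^sub>n, b)\<close>.
\<close>

definition mpoly_eval ::
    "('k, 'r) ring_scheme \<Rightarrow> ('k, 'a, 'm) module_scheme \<Rightarrow> (nat multiset \<Rightarrow> 'k) \<Rightarrow> (nat \<Rightarrow> 'a) \<Rightarrow> 'a"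
  where "mpoly_eval k A P x =
    (\<Oplus>\<^bsub>A\<^esub>m\<in>{m. P m \<noteq> \<zero>\<^bsub>k\<^esub>}.
       P m \<odot>\<^bsub>A\<^esub> (\<Otimes>\<^bsub>A\<^esub>i\<in>set_mset m. x i [^]\<^bsub>A\<^esub> count m i))"

definition homogeneous :: "('k, 'r) ring_scheme \<Rightarrow> (nat multiset \<Rightarrow> 'k) \<Rightarrow> bool"
  where "homogeneous k P \<longleftrightarrow> (\<exists>d. \<forall>m. P m \<noteq> \<zero>\<^bsub>k\<^esub> \<longrightarrow> size m = d)"

definition self_algebra :: "('k, 'r) ring_scheme \<Rightarrow> ('k, 'k) module"
  where "self_algebra k =
    \<lparr>carrier = carrier k, monoid.mult = monoid.mult k, one = one k, zero = zero k, add = add k,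
     smult = monoid.mult k\<rparr>"


section \<open>Special ideals and the special radical\<close>

text \<open>
  The number \<open>n\<close> of variables \<open>X\<^sub>1, \<dots>, X\<^sub>n\<close> is recorded together with the polynomial.
\<close>

definition homogeneous_signature :: "('k, 'r) ring_scheme \<Rightarrow> (nat \<times> (nat multiset \<Rightarrow> 'k)) set"
  where "homogeneous_signature k =
    {(n, P). P \<in> ring.indexed_pset k {0..n} (carrier k) \<and> P \<noteq> (\<lambda>m. \<zero>\<^bsub>k\<^esub>) \<and> homogeneous k P \<and>
       (\<forall>a \<in> {1..n} \<rightarrow> carrier k. \<forall>b \<in> carrier k.
          mpoly_eval k (self_algebra k) P (a(0 := b)) = \<zero>\<^bsub>k\<^esub> \<longrightarrow> b = \<zero>\<^bsub>k\<^esub>)}"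

definition special_ideal ::
    "('k, 'r) ring_scheme \<Rightarrow> ('k, 'a, 'm) module_scheme \<Rightarrow> 'a set \<Rightarrow> bool"
  where "special_ideal k A I \<longleftrightarrow> ideal I A \<and>
    (\<forall>(n, P) \<in> homogeneous_signature k. \<forall>a \<in> {1..n} \<rightarrow> carrier A. \<forall>b \<in> carrier A.
       mpoly_eval k A P (a(0 := b)) \<in> I \<longrightarrow> b \<in> I)"

text \<open>Intersecting with the carrier only matters when there are no special primes above \<open>I\<close>.\<close>

definition special_radical ::
    "('k, 'r) ring_scheme \<Rightarrow> ('k, 'a, 'm) module_scheme \<Rightarrow> 'a set \<Rightarrow> 'a set"
  where "special_radical k A I =
    carrier A \<inter> \<Inter>{Q. primeideal Q A \<and> special_ideal k A Q \<and> I \<subseteq> Q}"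


section \<open>Localization of an algebra\<close>

definition loc_rel :: "('k, 'a, 'm) module_scheme \<Rightarrow> 'a set \<Rightarrow> (('a \<times> 'a) \<times> ('a \<times> 'a)) set"
  where "loc_rel A S =
    {((a, s), (b, t)). a \<in> carrier A \<and> s \<in> S \<and> b \<in> carrier A \<and> t \<in> S \<and>
       (\<exists>u\<in>S. u \<otimes>\<^bsub>A\<^esub> (t \<otimes>\<^bsub>A\<^esub> a) = u \<otimes>\<^bsub>A\<^esub> (s \<otimes>\<^bsub>A\<^esub> b))}"

definition loc_frac :: "('k, 'a, 'm) module_scheme \<Rightarrow> 'a set \<Rightarrow> 'a \<Rightarrow> 'a \<Rightarrow> ('a \<times> 'a) set"
  where "loc_frac A S a s = loc_rel A S `` {(a, s)}"

text \<open>
  The operations are given on equivalence classes as the union of the results over all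
  representatives; that this does not depend on representatives is shown below.
\<close>

definition localization ::
    "('k, 'a, 'm) module_scheme \<Rightarrow> 'a set \<Rightarrow> ('k, ('a \<times> 'a) set) module"
  where "localization A S =
    \<lparr>carrier = (carrier A \<times> S) // loc_rel A S,
     monoid.mult = (\<lambda>U V. \<Union>(a, s)\<in>U. \<Union>(b, t)\<in>V. loc_frac A S (a \<otimes>\<^bsub>A\<^esub> b) (s \<otimes>\<^bsub>A\<^esub> t)),
     one = loc_frac A S \<one>\<^bsub>A\<^esub> \<one>\<^bsub>A\<^esub>,
     zero = loc_frac A S \<zero>\<^bsub>A\<^esub> \<one>\<^bsub>A\<^esub>,
     add = (\<lambda>U V. \<Union>(a, s)\<in>U. \<Union>(b, t)\<in>V.
              loc_frac A S ((t \<otimes>\<^bsub>A\<^esub> a) \<oplus>\<^bsub>A\<^esub> (s \<otimes>\<^bsub>A\<^esub> b)) (s \<otimes>\<^bsub>A\<^esub> t)),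
     smult = (\<lambda>c U. \<Union>(a, s)\<in>U. loc_frac A S (c \<odot>\<^bsub>A\<^esub> a) s)\<rparr>"

definition loc_ideal :: "('k, 'a, 'm) module_scheme \<Rightarrow> 'a set \<Rightarrow> 'a set \<Rightarrow> ('a \<times> 'a) set set"
  where "loc_ideal A S J = {loc_frac A S a s | a s. a \<in> J \<and> s \<in> S}"


subsection \<open>Well-definedness\<close>

locale algebra_localization = algebra R A + sub: submonoid S A for R and A (structure) and S
begin

lemma S_carrier: "s \<in> S \<Longrightarrow> s \<in> carrier A"
  using sub.subset by blast

lemma loc_rel_equiv: "equiv (carrier A \<times> S) (loc_rel A S)"
proof (rule equivI)
  show "loc_rel A S \<subseteq> (carrier A \<times> S) \<times> carrier A \<times> S"
    by (auto simp: loc_rel_def)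
  show "refl_on (carrier A \<times> S) (loc_rel A S)"
    by (auto simp: refl_on_def loc_rel_def intro!: bexI[of _ "\<one>\<^bsub>A\<^esub>"])
  show "sym (loc_rel A S)"
    by (auto simp: sym_def loc_rel_def) metis
  show "trans (loc_rel A S)"
  proof (rule transI, clarify)
    fix a s b t c r
    assume "((a, s), (b, t)) \<in> loc_rel A S" "((b, t), (c, r)) \<in> loc_rel A S"
    then obtain u v where S: "s \<in> S" "t \<in> S" "r \<in> S" "u \<in> S" "v \<in> S"
      and A: "a \<in> carrier A" "b \<in> carrier A" "c \<in> carrier A"
      and u: "u \<otimes>\<^bsub>A\<^esub> (t \<otimes>\<^bsub>A\<^esub> a) = u \<otimes>\<^bsub>A\<^esub> (s \<otimes>\<^bsub>A\<^esub> b)"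
      and v: "v \<otimes>\<^bsub>A\<^esub> (r \<otimes>\<^bsub>A\<^esub> b) = v \<otimes>\<^bsub>A\<^esub> (t \<otimes>\<^bsub>A\<^esub> c)"
      by (auto simp: loc_rel_def)
    note SA = S[THEN S_carrier]
    have "(u \<otimes>\<^bsub>A\<^esub> v \<otimes>\<^bsub>A\<^esub> t) \<otimes>\<^bsub>A\<^esub> (r \<otimes>\<^bsub>A\<^esub> a) = (v \<otimes>\<^bsub>A\<^esub> r) \<otimes>\<^bsub>A\<^esub> (u \<otimes>\<^bsub>A\<^esub> (t \<otimes>\<^bsub>A\<^esub> a))"
      using SA A by (simp add: m_ac)
    also have "\<dots> = (u \<otimes>\<^bsub>A\<^esub> s) \<otimes>\<^bsub>A\<^esub> (v \<otimes>\<^bsub>A\<^esub> (r \<otimes>\<^bsub>A\<^esub> b))"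
      unfolding u using SA A by (simp add: m_ac)
    also have "\<dots> = (u \<otimes>\<^bsub>A\<^esub> v \<otimes>\<^bsub>A\<^esub> t) \<otimes>\<^bsub>A\<^esub> (s \<otimes>\<^bsub>A\<^esub> c)"
      unfolding v using SA A by (simp add: m_ac)
    finally show "((a, s), (c, r)) \<in> loc_rel A S"
      unfolding loc_rel_def using S A sub.m_closed by blast
  qed
qed

lemma loc_frac_eq_iff:
  assumes "a \<in> carrier A" "s \<in> S" "b \<in> carrier A" "t \<in> S"
  shows "loc_frac A S a s = loc_frac A S b t \<longleftrightarrow>
    (\<exists>u\<in>S. u \<otimes>\<^bsub>A\<^esub> (t \<otimes>\<^bsub>A\<^esub> a) = u \<otimes>\<^bsub>A\<^esub> (s \<otimes>\<^bsub>A\<^esub> b))"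
  unfolding loc_frac_def using assms by (subst eq_equiv_class_iff[OF loc_rel_equiv]) (auto simp: loc_rel_def)

lemma loc_frac_eqI:
  assumes "u \<otimes>\<^bsub>A\<^esub> (t \<otimes>\<^bsub>A\<^esub> a) = u \<otimes>\<^bsub>A\<^esub> (s \<otimes>\<^bsub>A\<^esub> b)" "u \<in> S"
    and "a \<in> carrier A" "s \<in> S" "b \<in> carrier A" "t \<in> S"
  shows "loc_frac A S a s = loc_frac A S b t"
  using assms by (auto simp: loc_frac_eq_iff)

lemma loc_frac_eqI1:
  assumes "t \<otimes>\<^bsub>A\<^esub> a = s \<otimes>\<^bsub>A\<^esub> b" "a \<in> carrier A" "s \<in> S" "b \<in> carrier A" "t \<in> S"
  shows "loc_frac A S a s = loc_frac A S b t"
  by (rule loc_frac_eqI[of "\<one>\<^bsub>A\<^esub>"]) (use assms in auto)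

lemma loc_frac_closed [simp, intro]:
  "a \<in> carrier A \<Longrightarrow> s \<in> S \<Longrightarrow> loc_frac A S a s \<in> carrier (localization A S)"
  by (auto simp: localization_def loc_frac_def intro: quotientI)

lemma loc_cases:
  assumes "U \<in> carrier (localization A S)"
  obtains a s where "a \<in> carrier A" "s \<in> S" "U = loc_frac A S a s"
  using assms by (auto simp: localization_def loc_frac_def elim!: quotientE)

lemma UN_loc_frac:
  assumes "a \<in> carrier A" "s \<in> S"
    and "\<And>b t. b \<in> carrier A \<Longrightarrow> t \<in> S \<Longrightarrow> loc_frac A S a s = loc_frac A S b t \<Longrightarrow> f b t = f a s"
  shows "(\<Union>(b, t)\<in>loc_frac A S a s. f b t) = f a s"
proof -
  have mem: "(a, s) \<in> loc_frac A S a s"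
    unfolding loc_frac_def by (rule equiv_class_self[OF loc_rel_equiv]) (simp add: assms(1,2))
  have eq: "f (fst p) (snd p) = f a s" if p: "p \<in> loc_frac A S a s" for p
  proof -
    obtain b t where bt: "p = (b, t)" by (cases p)
    have rel: "((a, s), (b, t)) \<in> loc_rel A S" using p bt by (simp add: loc_frac_def)
    have "loc_frac A S a s = loc_frac A S b t"
      unfolding loc_frac_def using rel by (rule equiv_class_eq[OF loc_rel_equiv])
    moreover have "b \<in> carrier A" "t \<in> S" using rel by (simp_all add: loc_rel_def)
    ultimately show ?thesis using assms(3) bt by simp
  qed
  have "(\<Union>(b, t)\<in>loc_frac A S a s. f b t) = (\<Union>p\<in>loc_frac A S a s. f a s)"
    using eq by (intro SUP_cong refl) (simp add: case_prod_unfold)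
  also have "\<dots> = f a s" using mem by blast
  finally show ?thesis .
qed

lemma mult_frac_cong:
  assumes "a \<in> carrier A" "s \<in> S" "a' \<in> carrier A" "s' \<in> S" "b \<in> carrier A" "t \<in> S"
    and "loc_frac A S a s = loc_frac A S a' s'"
  shows "loc_frac A S (a' \<otimes>\<^bsub>A\<^esub> b) (s' \<otimes>\<^bsub>A\<^esub> t) = loc_frac A S (a \<otimes>\<^bsub>A\<^esub> b) (s \<otimes>\<^bsub>A\<^esub> t)"
proof -
  obtain u where u: "u \<in> S" "u \<otimes>\<^bsub>A\<^esub> (s' \<otimes>\<^bsub>A\<^esub> a) = u \<otimes>\<^bsub>A\<^esub> (s \<otimes>\<^bsub>A\<^esub> a')"
    using assms by (auto simp: loc_frac_eq_iff)
  note SA = assms(1,3,5) assms(2,4,6)[THEN S_carrier] u(1)[THEN S_carrier]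
  have "u \<otimes>\<^bsub>A\<^esub> ((s \<otimes>\<^bsub>A\<^esub> t) \<otimes>\<^bsub>A\<^esub> (a' \<otimes>\<^bsub>A\<^esub> b)) = (u \<otimes>\<^bsub>A\<^esub> (s \<otimes>\<^bsub>A\<^esub> a')) \<otimes>\<^bsub>A\<^esub> (t \<otimes>\<^bsub>A\<^esub> b)"
    using SA by (simp add: m_ac)
  also have "\<dots> = u \<otimes>\<^bsub>A\<^esub> ((s' \<otimes>\<^bsub>A\<^esub> t) \<otimes>\<^bsub>A\<^esub> (a \<otimes>\<^bsub>A\<^esub> b))"
    unfolding u(2)[symmetric] using SA by (simp add: m_ac)
  finally show ?thesis
    using assms u SA by (intro loc_frac_eqI[of u]) auto
qed

lemma add_frac_cong:
  assumes "a \<in> carrier A" "s \<in> S" "a' \<in> carrier A" "s' \<in> S" "b \<in> carrier A" "t \<in> S"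
    and "loc_frac A S a s = loc_frac A S a' s'"
  shows "loc_frac A S (t \<otimes>\<^bsub>A\<^esub> a' \<oplus>\<^bsub>A\<^esub> s' \<otimes>\<^bsub>A\<^esub> b) (s' \<otimes>\<^bsub>A\<^esub> t) =
         loc_frac A S (t \<otimes>\<^bsub>A\<^esub> a \<oplus>\<^bsub>A\<^esub> s \<otimes>\<^bsub>A\<^esub> b) (s \<otimes>\<^bsub>A\<^esub> t)"
proof -
  obtain u where u: "u \<in> S" "u \<otimes>\<^bsub>A\<^esub> (s' \<otimes>\<^bsub>A\<^esub> a) = u \<otimes>\<^bsub>A\<^esub> (s \<otimes>\<^bsub>A\<^esub> a')"
    using assms by (auto simp: loc_frac_eq_iff)
  note SA = assms(1,3,5) assms(2,4,6)[THEN S_carrier] u(1)[THEN S_carrier]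
  have "u \<otimes>\<^bsub>A\<^esub> ((s \<otimes>\<^bsub>A\<^esub> t) \<otimes>\<^bsub>A\<^esub> (t \<otimes>\<^bsub>A\<^esub> a' \<oplus>\<^bsub>A\<^esub> s' \<otimes>\<^bsub>A\<^esub> b)) =
      (t \<otimes>\<^bsub>A\<^esub> t) \<otimes>\<^bsub>A\<^esub> (u \<otimes>\<^bsub>A\<^esub> (s \<otimes>\<^bsub>A\<^esub> a')) \<oplus>\<^bsub>A\<^esub> u \<otimes>\<^bsub>A\<^esub> ((s \<otimes>\<^bsub>A\<^esub> t) \<otimes>\<^bsub>A\<^esub> (s' \<otimes>\<^bsub>A\<^esub> b))"
    using SA by (simp add: m_ac r_distr)
  also have "\<dots> = u \<otimes>\<^bsub>A\<^esub> ((s' \<otimes>\<^bsub>A\<^esub> t) \<otimes>\<^bsub>A\<^esub> (t \<otimes>\<^bsub>A\<^esub> a \<oplus>\<^bsub>A\<^esub> s \<otimes>\<^bsub>A\<^esub> b))"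
    unfolding u(2)[symmetric] using SA by (simp add: m_ac r_distr)
  finally show ?thesis
    using assms u SA by (intro loc_frac_eqI[of u]) auto
qed

lemma loc_mult_frac:
  assumes "a \<in> carrier A" "s \<in> S" "b \<in> carrier A" "t \<in> S"
  shows "loc_frac A S a s \<otimes>\<^bsub>localization A S\<^esub> loc_frac A S b t = loc_frac A S (a \<otimes>\<^bsub>A\<^esub> b) (s \<otimes>\<^bsub>A\<^esub> t)"
proof -
  have inner: "(\<Union>(b, t)\<in>loc_frac A S b t. loc_frac A S (a \<otimes>\<^bsub>A\<^esub> b) (s \<otimes>\<^bsub>A\<^esub> t)) =
      loc_frac A S (a \<otimes>\<^bsub>A\<^esub> b) (s \<otimes>\<^bsub>A\<^esub> t)" if "a \<in> carrier A" "s \<in> S" for a s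
  proof (rule UN_loc_frac)
    fix b' t' assume *: "b' \<in> carrier A" "t' \<in> S" "loc_frac A S b t = loc_frac A S b' t'"
    show "loc_frac A S (a \<otimes>\<^bsub>A\<^esub> b') (s \<otimes>\<^bsub>A\<^esub> t') = loc_frac A S (a \<otimes>\<^bsub>A\<^esub> b) (s \<otimes>\<^bsub>A\<^esub> t)"
      using mult_frac_cong[OF assms(3,4) *(1,2) that *(3)] * that assms by (simp add: m_comm S_carrier)
  qed (use assms in auto)
  have "(\<Union>(a, s)\<in>loc_frac A S a s. \<Union>(b, t)\<in>loc_frac A S b t. loc_frac A S (a \<otimes>\<^bsub>A\<^esub> b) (s \<otimes>\<^bsub>A\<^esub> t))
      = (\<Union>(b, t)\<in>loc_frac A S b t. loc_frac A S (a \<otimes>\<^bsub>A\<^esub> b) (s \<otimes>\<^bsub>A\<^esub> t))"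
  proof (rule UN_loc_frac)
    fix a' s' assume *: "a' \<in> carrier A" "s' \<in> S" "loc_frac A S a s = loc_frac A S a' s'"
    show "(\<Union>(b, t)\<in>loc_frac A S b t. loc_frac A S (a' \<otimes>\<^bsub>A\<^esub> b) (s' \<otimes>\<^bsub>A\<^esub> t)) =
        (\<Union>(b, t)\<in>loc_frac A S b t. loc_frac A S (a \<otimes>\<^bsub>A\<^esub> b) (s \<otimes>\<^bsub>A\<^esub> t))"
      unfolding inner[OF *(1,2)] inner[OF assms(1,2)]
      by (rule mult_frac_cong[OF assms(1,2) *(1,2) assms(3,4) *(3)])
  qed (use assms in auto)
  then show ?thesis
    using inner assms by (simp add: localization_def)
qed

lemma loc_add_frac:
  assumes "a \<in> carrier A" "s \<in> S" "b \<in> carrier A" "t \<in> S"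
  shows "loc_frac A S a s \<oplus>\<^bsub>localization A S\<^esub> loc_frac A S b t =
    loc_frac A S (t \<otimes>\<^bsub>A\<^esub> a \<oplus>\<^bsub>A\<^esub> s \<otimes>\<^bsub>A\<^esub> b) (s \<otimes>\<^bsub>A\<^esub> t)"
proof -
  have inner: "(\<Union>(b, t)\<in>loc_frac A S b t. loc_frac A S (t \<otimes>\<^bsub>A\<^esub> a \<oplus>\<^bsub>A\<^esub> s \<otimes>\<^bsub>A\<^esub> b) (s \<otimes>\<^bsub>A\<^esub> t)) =
      loc_frac A S (t \<otimes>\<^bsub>A\<^esub> a \<oplus>\<^bsub>A\<^esub> s \<otimes>\<^bsub>A\<^esub> b) (s \<otimes>\<^bsub>A\<^esub> t)" if "a \<in> carrier A" "s \<in> S" for a s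
  proof (rule UN_loc_frac)
    fix b' t' assume *: "b' \<in> carrier A" "t' \<in> S" "loc_frac A S b t = loc_frac A S b' t'"
    show "loc_frac A S (t' \<otimes>\<^bsub>A\<^esub> a \<oplus>\<^bsub>A\<^esub> s \<otimes>\<^bsub>A\<^esub> b') (s \<otimes>\<^bsub>A\<^esub> t') =
        loc_frac A S (t \<otimes>\<^bsub>A\<^esub> a \<oplus>\<^bsub>A\<^esub> s \<otimes>\<^bsub>A\<^esub> b) (s \<otimes>\<^bsub>A\<^esub> t)"
      using add_frac_cong[OF assms(3,4) *(1,2) that *(3)] * that assms
      by (simp add: m_comm M.a_comm S_carrier)
  qed (use assms in auto)
  have "(\<Union>(a, s)\<in>loc_frac A S a s. \<Union>(b, t)\<in>loc_frac A S b t.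
        loc_frac A S (t \<otimes>\<^bsub>A\<^esub> a \<oplus>\<^bsub>A\<^esub> s \<otimes>\<^bsub>A\<^esub> b) (s \<otimes>\<^bsub>A\<^esub> t))
      = (\<Union>(b, t)\<in>loc_frac A S b t. loc_frac A S (t \<otimes>\<^bsub>A\<^esub> a \<oplus>\<^bsub>A\<^esub> s \<otimes>\<^bsub>A\<^esub> b) (s \<otimes>\<^bsub>A\<^esub> t))"
  proof (rule UN_loc_frac)
    fix a' s' assume *: "a' \<in> carrier A" "s' \<in> S" "loc_frac A S a s = loc_frac A S a' s'"
    show "(\<Union>(b, t)\<in>loc_frac A S b t. loc_frac A S (t \<otimes>\<^bsub>A\<^esub> a' \<oplus>\<^bsub>A\<^esub> s' \<otimes>\<^bsub>A\<^esub> b) (s' \<otimes>\<^bsub>A\<^esub> t)) =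
        (\<Union>(b, t)\<in>loc_frac A S b t. loc_frac A S (t \<otimes>\<^bsub>A\<^esub> a \<oplus>\<^bsub>A\<^esub> s \<otimes>\<^bsub>A\<^esub> b) (s \<otimes>\<^bsub>A\<^esub> t))"
      unfolding inner[OF *(1,2)] inner[OF assms(1,2)]
      by (rule add_frac_cong[OF assms(1,2) *(1,2) assms(3,4) *(3)])
  qed (use assms in auto)
  then show ?thesis
    using inner assms by (simp add: localization_def)
qed

lemma smult_mult:
  assumes "c \<in> carrier R" "a \<in> carrier A" "b \<in> carrier A"
  shows "a \<otimes>\<^bsub>A\<^esub> (c \<odot>\<^bsub>A\<^esub> b) = c \<odot>\<^bsub>A\<^esub> (a \<otimes>\<^bsub>A\<^esub> b)"
  using assms by (metis m_comm smult_assoc2 smult_closed)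

lemma loc_smult_frac:
  assumes "c \<in> carrier R" "a \<in> carrier A" "s \<in> S"
  shows "c \<odot>\<^bsub>localization A S\<^esub> loc_frac A S a s = loc_frac A S (c \<odot>\<^bsub>A\<^esub> a) s"
proof -
  have "(\<Union>(a, s)\<in>loc_frac A S a s. loc_frac A S (c \<odot>\<^bsub>A\<^esub> a) s) = loc_frac A S (c \<odot>\<^bsub>A\<^esub> a) s"
  proof (rule UN_loc_frac)
    fix b t assume *: "b \<in> carrier A" "t \<in> S" "loc_frac A S a s = loc_frac A S b t"
    then obtain u where u: "u \<in> S" "u \<otimes>\<^bsub>A\<^esub> (t \<otimes>\<^bsub>A\<^esub> a) = u \<otimes>\<^bsub>A\<^esub> (s \<otimes>\<^bsub>A\<^esub> b)"
      using assms by (auto simp: loc_frac_eq_iff)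
    then show "loc_frac A S (c \<odot>\<^bsub>A\<^esub> b) t = loc_frac A S (c \<odot>\<^bsub>A\<^esub> a) s"
      using assms * by (intro loc_frac_eqI[of u]) (auto simp: smult_mult S_carrier)
  qed (use assms in auto)
  then show ?thesis by (simp add: localization_def)
qed

lemma loc_zero: "\<zero>\<^bsub>localization A S\<^esub> = loc_frac A S \<zero>\<^bsub>A\<^esub> \<one>\<^bsub>A\<^esub>"
  and loc_one: "\<one>\<^bsub>localization A S\<^esub> = loc_frac A S \<one>\<^bsub>A\<^esub> \<one>\<^bsub>A\<^esub>"
  by (simp_all add: localization_def)

lemma loc_frac_uminus:
  assumes "a \<in> carrier A" "s \<in> S"
  shows "loc_frac A S (\<ominus>\<^bsub>A\<^esub> a) s \<oplus>\<^bsub>localization A S\<^esub> loc_frac A S a s = \<zero>\<^bsub>localization A S\<^esub>"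
  using assms by (simp add: loc_add_frac loc_zero r_minus S_carrier M.l_neg) (rule loc_frac_eqI1, simp_all add: S_carrier)

lemma loc_cring: "cring (localization A S)"
proof (rule cringI)
  show "abelian_group (localization A S)"
  proof (rule abelian_groupI)
    fix U V W
    assume U: "U \<in> carrier (localization A S)" and V: "V \<in> carrier (localization A S)"
    obtain a s where a: "a \<in> carrier A" "s \<in> S" "U = loc_frac A S a s" using U by (rule loc_cases)
    obtain b t where b: "b \<in> carrier A" "t \<in> S" "V = loc_frac A S b t" using V by (rule loc_cases)
    show "U \<oplus>\<^bsub>localization A S\<^esub> V \<in> carrier (localization A S)"
      using a b by (simp add: loc_add_frac S_carrier)
    show "U \<oplus>\<^bsub>localization A S\<^esub> V = V \<oplus>\<^bsub>localization A S\<^esub> U"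
      using a b by (simp add: loc_add_frac S_carrier M.a_comm m_comm)
    assume W: "W \<in> carrier (localization A S)"
    obtain c r where c: "c \<in> carrier A" "r \<in> S" "W = loc_frac A S c r" using W by (rule loc_cases)
    show "U \<oplus>\<^bsub>localization A S\<^esub> V \<oplus>\<^bsub>localization A S\<^esub> W = U \<oplus>\<^bsub>localization A S\<^esub> (V \<oplus>\<^bsub>localization A S\<^esub> W)"
      using a b c by (simp add: loc_add_frac S_carrier M.a_assoc m_ac r_distr)
  next
    show "\<zero>\<^bsub>localization A S\<^esub> \<in> carrier (localization A S)"
      by (simp add: loc_zero)
  next
    fix U assume "U \<in> carrier (localization A S)"
    then obtain a s where a: "a \<in> carrier A" "s \<in> S" "U = loc_frac A S a s" by (rule loc_cases)
    show "\<zero>\<^bsub>localization A S\<^esub> \<oplus>\<^bsub>localization A S\<^esub> U = U"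
      using a by (simp add: loc_zero loc_add_frac S_carrier)
    show "\<exists>V\<in>carrier (localization A S). V \<oplus>\<^bsub>localization A S\<^esub> U = \<zero>\<^bsub>localization A S\<^esub>"
      using a by (intro bexI[of _ "loc_frac A S (\<ominus>\<^bsub>A\<^esub> a) s"]) (auto simp: loc_frac_uminus)
  qed
  show "Group.comm_monoid (localization A S)"
  proof (rule comm_monoidI)
    fix U V W
    assume U: "U \<in> carrier (localization A S)" and V: "V \<in> carrier (localization A S)"
    obtain a s where a: "a \<in> carrier A" "s \<in> S" "U = loc_frac A S a s" using U by (rule loc_cases)
    obtain b t where b: "b \<in> carrier A" "t \<in> S" "V = loc_frac A S b t" using V by (rule loc_cases)
    show "U \<otimes>\<^bsub>localization A S\<^esub> V \<in> carrier (localization A S)"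
      using a b by (simp add: loc_mult_frac S_carrier)
    show "U \<otimes>\<^bsub>localization A S\<^esub> V = V \<otimes>\<^bsub>localization A S\<^esub> U"
      using a b by (simp add: loc_mult_frac S_carrier m_comm)
    assume W: "W \<in> carrier (localization A S)"
    obtain c r where c: "c \<in> carrier A" "r \<in> S" "W = loc_frac A S c r" using W by (rule loc_cases)
    show "U \<otimes>\<^bsub>localization A S\<^esub> V \<otimes>\<^bsub>localization A S\<^esub> W = U \<otimes>\<^bsub>localization A S\<^esub> (V \<otimes>\<^bsub>localization A S\<^esub> W)"
      using a b c by (simp add: loc_mult_frac S_carrier m_assoc)
  next
    show "\<one>\<^bsub>localization A S\<^esub> \<in> carrier (localization A S)"
      by (simp add: loc_one)
  next
    fix U assume "U \<in> carrier (localization A S)"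
    then obtain a s where a: "a \<in> carrier A" "s \<in> S" "U = loc_frac A S a s" by (rule loc_cases)
    show "\<one>\<^bsub>localization A S\<^esub> \<otimes>\<^bsub>localization A S\<^esub> U = U"
      using a by (simp add: loc_one loc_mult_frac S_carrier)
  qed
next
  fix U V W
  assume UVW: "U \<in> carrier (localization A S)" "V \<in> carrier (localization A S)"
    "W \<in> carrier (localization A S)"
  obtain a s where a: "a \<in> carrier A" "s \<in> S" "U = loc_frac A S a s" using UVW(1) by (rule loc_cases)
  obtain b t where b: "b \<in> carrier A" "t \<in> S" "V = loc_frac A S b t" using UVW(2) by (rule loc_cases)
  obtain c r where c: "c \<in> carrier A" "r \<in> S" "W = loc_frac A S c r" using UVW(3) by (rule loc_cases)
  note carr = a(1) b(1) c(1) a(2)[THEN S_carrier] b(2)[THEN S_carrier] c(2)[THEN S_carrier]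
  have "loc_frac A S ((t \<otimes>\<^bsub>A\<^esub> a \<oplus>\<^bsub>A\<^esub> s \<otimes>\<^bsub>A\<^esub> b) \<otimes>\<^bsub>A\<^esub> c) ((s \<otimes>\<^bsub>A\<^esub> t) \<otimes>\<^bsub>A\<^esub> r) =
    loc_frac A S ((t \<otimes>\<^bsub>A\<^esub> r) \<otimes>\<^bsub>A\<^esub> (a \<otimes>\<^bsub>A\<^esub> c) \<oplus>\<^bsub>A\<^esub> (s \<otimes>\<^bsub>A\<^esub> r) \<otimes>\<^bsub>A\<^esub> (b \<otimes>\<^bsub>A\<^esub> c))
      ((s \<otimes>\<^bsub>A\<^esub> r) \<otimes>\<^bsub>A\<^esub> (t \<otimes>\<^bsub>A\<^esub> r))"
    by (rule loc_frac_eqI1) (use a b c carr in \<open>simp_all add: l_distr r_distr m_ac\<close>)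
  then show "(U \<oplus>\<^bsub>localization A S\<^esub> V) \<otimes>\<^bsub>localization A S\<^esub> W =
      U \<otimes>\<^bsub>localization A S\<^esub> W \<oplus>\<^bsub>localization A S\<^esub> V \<otimes>\<^bsub>localization A S\<^esub> W"
    using a b c carr by (simp add: loc_add_frac loc_mult_frac)
qed

lemma loc_algebra: "algebra R (localization A S)"
proof (rule algebraI)
  show "cring R" by (rule R_cring)
  show "cring (localization A S)" by (rule loc_cring)
next
  fix c U assume c: "c \<in> carrier R" and "U \<in> carrier (localization A S)"
  then obtain a s where a: "a \<in> carrier A" "s \<in> S" "U = loc_frac A S a s" by (metis loc_cases)
  show "c \<odot>\<^bsub>localization A S\<^esub> U \<in> carrier (localization A S)"
    using c a by (simp add: loc_smult_frac)
next
  fix c d U assume c: "c \<in> carrier R" "d \<in> carrier R" and "U \<in> carrier (localization A S)"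
  then obtain a s where a: "a \<in> carrier A" "s \<in> S" "U = loc_frac A S a s" by (metis loc_cases)
  have "loc_frac A S ((c \<oplus>\<^bsub>R\<^esub> d) \<odot>\<^bsub>A\<^esub> a) s =
      loc_frac A S (s \<otimes>\<^bsub>A\<^esub> (c \<odot>\<^bsub>A\<^esub> a) \<oplus>\<^bsub>A\<^esub> s \<otimes>\<^bsub>A\<^esub> (d \<odot>\<^bsub>A\<^esub> a)) (s \<otimes>\<^bsub>A\<^esub> s)"
    by (rule loc_frac_eqI1) (use c a in \<open>simp_all add: S_carrier smult_l_distr r_distr m_assoc\<close>)
  then show "(c \<oplus>\<^bsub>R\<^esub> d) \<odot>\<^bsub>localization A S\<^esub> U =
      c \<odot>\<^bsub>localization A S\<^esub> U \<oplus>\<^bsub>localization A S\<^esub> d \<odot>\<^bsub>localization A S\<^esub> U"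
    using c a by (simp add: loc_smult_frac loc_add_frac)
  show "(c \<otimes>\<^bsub>R\<^esub> d) \<odot>\<^bsub>localization A S\<^esub> U = c \<odot>\<^bsub>localization A S\<^esub> (d \<odot>\<^bsub>localization A S\<^esub> U)"
    using c a by (simp add: loc_smult_frac smult_assoc1)
next
  fix c U V
  assume c: "c \<in> carrier R" and UV: "U \<in> carrier (localization A S)" "V \<in> carrier (localization A S)"
  obtain a s where a: "a \<in> carrier A" "s \<in> S" "U = loc_frac A S a s" using UV(1) by (rule loc_cases)
  obtain b t where b: "b \<in> carrier A" "t \<in> S" "V = loc_frac A S b t" using UV(2) by (rule loc_cases)
  show "c \<odot>\<^bsub>localization A S\<^esub> (U \<oplus>\<^bsub>localization A S\<^esub> V) =
      c \<odot>\<^bsub>localization A S\<^esub> U \<oplus>\<^bsub>localization A S\<^esub> c \<odot>\<^bsub>localization A S\<^esub> V"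
    using c a b by (simp add: loc_smult_frac loc_add_frac smult_r_distr smult_mult S_carrier)
  show "c \<odot>\<^bsub>localization A S\<^esub> U \<otimes>\<^bsub>localization A S\<^esub> V = c \<odot>\<^bsub>localization A S\<^esub> (U \<otimes>\<^bsub>localization A S\<^esub> V)"
    using c a b by (simp add: loc_smult_frac loc_mult_frac smult_assoc2 S_carrier)
next
  fix U assume "U \<in> carrier (localization A S)"
  then obtain a s where a: "a \<in> carrier A" "s \<in> S" "U = loc_frac A S a s" by (rule loc_cases)
  then show "\<one>\<^bsub>R\<^esub> \<odot>\<^bsub>localization A S\<^esub> U = U"
    by (simp add: loc_smult_frac)
qed

lemma loc_idealI: "a \<in> J \<Longrightarrow> s \<in> S \<Longrightarrow> loc_frac A S a s \<in> loc_ideal A S J"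
  unfolding loc_ideal_def by blast

lemma loc_idealE:
  assumes "U \<in> loc_ideal A S J"
  obtains a s where "a \<in> J" "s \<in> S" "U = loc_frac A S a s"
  using assms unfolding loc_ideal_def by blast

lemma loc_ideal_ideal:
  assumes "ideal J A"
  shows "ideal (loc_ideal A S J) (localization A S)"
proof -
  interpret J: ideal J A by fact
  interpret L: cring "localization A S" by (rule loc_cring)
  have JA: "\<And>a. a \<in> J \<Longrightarrow> a \<in> carrier A" by (rule J.Icarr)
  have mult: "V \<otimes>\<^bsub>localization A S\<^esub> U \<in> loc_ideal A S J"
    if U: "U \<in> loc_ideal A S J" and V: "V \<in> carrier (localization A S)" for U V
  proof -
    obtain a s where a: "a \<in> J" "s \<in> S" "U = loc_frac A S a s" using U by (rule loc_idealE)
    obtain b t where b: "b \<in> carrier A" "t \<in> S" "V = loc_frac A S b t" using V by (rule loc_cases)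
    have "V \<otimes>\<^bsub>localization A S\<^esub> U = loc_frac A S (b \<otimes>\<^bsub>A\<^esub> a) (t \<otimes>\<^bsub>A\<^esub> s)"
      unfolding a(3) b(3) by (rule loc_mult_frac) (use a b JA in simp_all)
    then show ?thesis
      using a b by (simp add: loc_idealI J.I_l_closed)
  qed
  have sub: "loc_ideal A S J \<subseteq> carrier (localization A S)"
  proof
    fix U assume "U \<in> loc_ideal A S J"
    then obtain a s where a: "a \<in> J" "s \<in> S" "U = loc_frac A S a s" by (rule loc_idealE)
    show "U \<in> carrier (localization A S)"
      unfolding a(3) by (rule loc_frac_closed[OF JA[OF a(1)] a(2)])
  qed
  show ?thesis
  proof (rule idealI[OF L.ring_axioms])
    show "subgroup (loc_ideal A S J) (add_monoid (localization A S))"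
    proof (rule L.add.subgroupI)
      show "loc_ideal A S J \<subseteq> carrier (localization A S)" by (rule sub)
      show "loc_ideal A S J \<noteq> {}"
        using loc_idealI[OF J.zero_closed sub.one_closed] by blast
    next
      fix U assume "U \<in> loc_ideal A S J"
      then obtain a s where a: "a \<in> J" "s \<in> S" "U = loc_frac A S a s" by (rule loc_idealE)
      have "\<ominus>\<^bsub>localization A S\<^esub> U = loc_frac A S (\<ominus>\<^bsub>A\<^esub> a) s"
        unfolding a(3) by (intro L.minus_equality loc_frac_uminus loc_frac_closed) (use a JA in auto)
      then show "\<ominus>\<^bsub>localization A S\<^esub> U \<in> loc_ideal A S J"
        using a by (simp add: loc_idealI J.a_inv_closed)
    next
      fix U V assume U: "U \<in> loc_ideal A S J" and V: "V \<in> loc_ideal A S J"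
      obtain a s where a: "a \<in> J" "s \<in> S" "U = loc_frac A S a s" using U by (rule loc_idealE)
      obtain b t where b: "b \<in> J" "t \<in> S" "V = loc_frac A S b t" using V by (rule loc_idealE)
      have "U \<oplus>\<^bsub>localization A S\<^esub> V =
          loc_frac A S (t \<otimes>\<^bsub>A\<^esub> a \<oplus>\<^bsub>A\<^esub> s \<otimes>\<^bsub>A\<^esub> b) (s \<otimes>\<^bsub>A\<^esub> t)"
        unfolding a(3) b(3) by (rule loc_add_frac) (use a b JA in simp_all)
      then show "U \<oplus>\<^bsub>localization A S\<^esub> V \<in> loc_ideal A S J"
        using a b by (simp add: loc_idealI J.I_l_closed S_carrier)
    qed
  next
    fix U V assume U: "U \<in> loc_ideal A S J" and V: "V \<in> carrier (localization A S)"
    show "V \<otimes>\<^bsub>localization A S\<^esub> U \<in> loc_ideal A S J" using U V by (rule mult)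
    then show "U \<otimes>\<^bsub>localization A S\<^esub> V \<in> loc_ideal A S J"
      by (simp only: L.m_comm[OF subsetD[OF sub U] V])
  qed
qed

text \<open>\<open>S\<^sup>-\<^sup>1J = J A\<^sub>S\<close>: the fractions with numerator in \<open>J\<close> form the ideal generated by the image of \<open>J\<close>.\<close>

lemma loc_ideal_eq_genideal:
  assumes "ideal J A"
  shows "loc_ideal A S J = Idl\<^bsub>localization A S\<^esub> ((\<lambda>a. loc_frac A S a \<one>\<^bsub>A\<^esub>) ` J)"
    (is "_ = Idl\<^bsub>_\<^esub> ?G")
proof -
  interpret J: ideal J A by fact
  interpret L: cring "localization A S" by (rule loc_cring)
  have JA: "\<And>a. a \<in> J \<Longrightarrow> a \<in> carrier A" by (rule J.Icarr)
  have G: "?G \<subseteq> carrier (localization A S)"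
    by (intro image_subsetI loc_frac_closed JA sub.one_closed)
  show ?thesis
  proof (rule antisym)
    show "Idl\<^bsub>localization A S\<^esub> ?G \<subseteq> loc_ideal A S J"
    proof (rule L.genideal_minimal[OF loc_ideal_ideal[OF assms]])
      show "?G \<subseteq> loc_ideal A S J"
        by (intro image_subsetI loc_idealI sub.one_closed)
    qed
    show "loc_ideal A S J \<subseteq> Idl\<^bsub>localization A S\<^esub> ?G"
    proof
      fix U assume "U \<in> loc_ideal A S J"
      then obtain a s where a: "a \<in> J" "s \<in> S" "U = loc_frac A S a s" by (rule loc_idealE)
      have "loc_frac A S \<one>\<^bsub>A\<^esub> s \<otimes>\<^bsub>localization A S\<^esub> loc_frac A S a \<one>\<^bsub>A\<^esub> =
          loc_frac A S (\<one>\<^bsub>A\<^esub> \<otimes>\<^bsub>A\<^esub> a) (s \<otimes>\<^bsub>A\<^esub> \<one>\<^bsub>A\<^esub>)"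
        by (rule loc_mult_frac) (use a JA in simp_all)
      then have "U = loc_frac A S \<one>\<^bsub>A\<^esub> s \<otimes>\<^bsub>localization A S\<^esub> loc_frac A S a \<one>\<^bsub>A\<^esub>"
        using a JA by (simp add: S_carrier)
      also have "\<dots> \<in> Idl\<^bsub>localization A S\<^esub> ?G"
      proof (rule ideal.I_l_closed[OF L.genideal_ideal[OF G]])
        show "loc_frac A S a \<one>\<^bsub>A\<^esub> \<in> Idl\<^bsub>localization A S\<^esub> ?G"
          using L.genideal_self[OF G] a(1) by blast
        show "loc_frac A S \<one>\<^bsub>A\<^esub> s \<in> carrier (localization A S)"
          using a(2) by simp
      qed
      finally show "U \<in> Idl\<^bsub>localization A S\<^esub> ?G" .
    qed
  qed
qed

end

end

theory Submission
  imports Defs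
begin

text \<open>
  The special radical is described by certificates: \<open>b \<in> \<surd>I\<close> if and only if \<open>P(a, b) \<in> I\<close> for some
  point \<open>a\<close> and some \<open>P\<close> in the signature. If there is no certificate, let \<open>Q\<close> be maximal among the
  ideals above \<open>I\<close> that avoid the set \<open>D\<close> of all values \<open>P(a, b)\<close> with \<open>P\<close> in the signature. A product
  of elements of \<open>D\<close> is in \<open>D\<close>, so \<open>Q\<close> is prime. The signature is closed under substitution
  for \<open>Y\<close>, so \<open>Q\<close> is special: if \<open>P(a, c) \<in> Q\<close> and \<open>c \<notin> Q\<close>, then some \<open>r = q + f c \<in> D\<close> with \<open>q \<in> Q\<close>,
  and \<open>P(f a, r)\<close>, which is an element of \<open>D\<close>, is congruent to \<open>P(f a, f c) = f\<^sup>d P(a, c)\<close> modulo \<open>Q\<close>.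
  By homogeneity, certificates can be localized, and common denominators can be cleared from them.
\<close>

section \<open>Evaluation of polynomials\<close>

definition monom_val :: "('k, 'a, 'm) module_scheme \<Rightarrow> (nat \<Rightarrow> 'a) \<Rightarrow> nat multiset \<Rightarrow> 'a"
  where "monom_val A x m = (\<Otimes>\<^bsub>A\<^esub>i\<in>set_mset m. x i [^]\<^bsub>A\<^esub> count m i)"

lemma mpoly_eval_eq:
  "mpoly_eval k A P x = (\<Oplus>\<^bsub>A\<^esub>m\<in>{m. P m \<noteq> \<zero>\<^bsub>k\<^esub>}. P m \<odot>\<^bsub>A\<^esub> monom_val A x m)"
  by (simp add: mpoly_eval_def monom_val_def)

context algebra
begin

text \<open>The additional indices have exponent 0 and contribute the factor 1. This brings
  monomials with different variables over one index set.\<close>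

lemma monom_val_superset:
  assumes "finite F" "set_mset m \<subseteq> F" "x \<in> F \<rightarrow> carrier M"
  shows "monom_val M x m = (\<Otimes>\<^bsub>M\<^esub>i\<in>F. x i [^]\<^bsub>M\<^esub> count m i)"
  unfolding monom_val_def
  by (rule finprod_mono_neutral_cong_left)
    (use assms in \<open>auto simp: Pi_def not_in_iff\<close>)

lemma monom_val_closed:
  assumes "x \<in> set_mset m \<rightarrow> carrier M"
  shows "monom_val M x m \<in> carrier M"
  unfolding monom_val_def by (rule finprod_closed) (use assms in \<open>auto simp: Pi_def\<close>)

lemma monom_val_cong:
  assumes "x \<in> set_mset m \<rightarrow> carrier M" "\<And>i. i \<in># m \<Longrightarrow> y i = x i"
  shows "monom_val M y m = monom_val M x m"
  unfolding monom_val_def by (rule finprod_cong') (use assms in \<open>auto simp: Pi_def\<close>)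

lemma monom_val_empty: "monom_val M x {#} = \<one>\<^bsub>M\<^esub>"
  by (simp add: monom_val_def)

lemma monom_val_single:
  assumes "x i \<in> carrier M"
  shows "monom_val M x {#i#} = x i"
  using assms by (simp add: monom_val_def)

lemma monom_val_add:
  assumes "x \<in> set_mset (m + n) \<rightarrow> carrier M"
  shows "monom_val M x (m + n) = monom_val M x m \<otimes>\<^bsub>M\<^esub> monom_val M x n"
proof -
  let ?F = "set_mset (m + n)"
  have "monom_val M x (m + n) = (\<Otimes>\<^bsub>M\<^esub>i\<in>?F. x i [^]\<^bsub>M\<^esub> count m i \<otimes>\<^bsub>M\<^esub> x i [^]\<^bsub>M\<^esub> count n i)"
    unfolding monom_val_def
    by (rule finprod_cong') (use assms in \<open>auto simp: Pi_def nat_pow_mult\<close>)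
  also have "\<dots> = monom_val M x m \<otimes>\<^bsub>M\<^esub> monom_val M x n"
    by (subst (1 2) monom_val_superset[of ?F]; (subst finprod_multf)?) (use assms in \<open>auto simp: Pi_def\<close>)
  finally show ?thesis .
qed

lemma mpoly_eval_superset:
  assumes "finite F" "{m. P m \<noteq> \<zero>\<^bsub>R\<^esub>} \<subseteq> F" "P \<in> F \<rightarrow> carrier R"
    and "x \<in> UNIV \<rightarrow> carrier M"
  shows "mpoly_eval R M P x = (\<Oplus>\<^bsub>M\<^esub>m\<in>F. P m \<odot>\<^bsub>M\<^esub> monom_val M x m)"
  unfolding mpoly_eval_eq
  by (rule M.add.finprod_mono_neutral_cong_left)
    (use assms in \<open>auto simp: Pi_def intro!: monom_val_closed smult_closed smult_l_null\<close>)

text \<open>A point of the signature is constrained only at the indices up to \<open>n\<close> and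
  may leave the carrier elsewhere. Hence \<open>y\<close> is compared with \<open>x\<close> on
  \<open>V\<close> alone.\<close>

lemma mpoly_eval_cong:
  assumes "P \<in> UNIV \<rightarrow> carrier R" "x \<in> V \<rightarrow> carrier M"
    and "\<And>m. P m \<noteq> \<zero>\<^bsub>R\<^esub> \<Longrightarrow> set_mset m \<subseteq> V" "\<And>i. i \<in> V \<Longrightarrow> y i = x i"
  shows "mpoly_eval R M P y = mpoly_eval R M P x"
  unfolding mpoly_eval_eq
proof (rule M.finsum_cong'[OF refl])
  show "(\<lambda>m. P m \<odot>\<^bsub>M\<^esub> monom_val M x m) \<in> {m. P m \<noteq> \<zero>\<^bsub>R\<^esub>} \<rightarrow> carrier M"
    proof (rule Pi_I)
    fix m assume "m \<in> {m. P m \<noteq> \<zero>\<^bsub>R\<^esub>}"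
    then have "x \<in> set_mset m \<rightarrow> carrier M" using assms(2) assms(3)[of m] by auto
    then show "P m \<odot>\<^bsub>M\<^esub> monom_val M x m \<in> carrier M"
      using assms(1) by (intro smult_closed monom_val_closed) auto
  qed
  fix m assume "m \<in> {m. P m \<noteq> \<zero>\<^bsub>R\<^esub>}"
  then have "set_mset m \<subseteq> V" using assms(3) by simp
  then have "monom_val M y m = monom_val M x m"
    using assms(2,4) by (intro monom_val_cong) auto
  then show "P m \<odot>\<^bsub>M\<^esub> monom_val M y m = P m \<odot>\<^bsub>M\<^esub> monom_val M x m" by simp
qed

end

text \<open>The last two facts follow the generation of \<open>indexed_pset\<close>. Finiteness
  matters because a \<open>finsum\<close> over an infinite set is zero by convention.\<close>

lemma (in ring) indexed_pset_support:
  assumes "P \<in> indexed_pset I (carrier R)"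
  shows "P m \<in> carrier R" "finite {m. P m \<noteq> \<zero>}" "P m \<noteq> \<zero> \<Longrightarrow> set_mset m \<subseteq> I"
proof -
  show "P m \<in> carrier R"
    using indexed_pset_in_carrier[OF subset_refl assms] by (simp add: carrier_coeff_def)
  show "finite {m. P m \<noteq> \<zero>}"
    using assms
  proof induction
    case (indexed_const c)
    show ?case by (rule finite_subset[of _ "{{#}}"]) (auto simp: indexed_const_def)
  next
    case (indexed_padd P Q)
    show ?case
      by (rule finite_subset[OF _ finite_UnI[OF indexed_padd.IH]]) (auto simp: indexed_padd_def)
  next
    case (indexed_pmult P i)
    \<comment> \<open>Multiplication by the variable \<open>i\<close> moves the support along
      \<open>add_mset i\<close>; removing one \<open>i\<close> from a monomial of the product gives
      its preimage.\<close>
    show ?case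
      by (rule finite_subset[OF _ finite_imageI[OF indexed_pmult.IH, of "add_mset i"]])
        (auto simp: indexed_pmult_def image_iff split: if_splits intro!: exI[of _ "_ - {#i#}"])
  qed
  show "P m \<noteq> \<zero> \<Longrightarrow> set_mset m \<subseteq> I"
    using assms
  proof (induction arbitrary: m)
    case (indexed_const c)
    then show ?case by (auto simp: indexed_const_def split: if_splits)
  next
    case (indexed_padd P Q)
    then have "P m \<noteq> \<zero> \<or> Q m \<noteq> \<zero>" by (auto simp: indexed_padd_def)
    then show ?case using indexed_padd.IH by blast
  next
    case (indexed_pmult P i)
    then have "i \<in># m" "P (m - {#i#}) \<noteq> \<zero>" by (auto simp: indexed_pmult_def split: if_splits)
    then show ?case
      using indexed_pmult.IH[of "m - {#i#}"] indexed_pmult.hyps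
      by (metis insert_DiffM insert_subset set_mset_add_mset_insert)
  qed
qed

section \<open>Polynomial expressions\<close>

text \<open>The library's indexed polynomials have neither a product nor a substitution. We compute with
  expressions, for which both are syntactic, and translate through lists of terms.\<close>

datatype 'k pexp = Con 'k | Var nat | Add "'k pexp" "'k pexp" | Mul "'k pexp" "'k pexp"

primrec pval :: "('k, 'a, 'm) module_scheme \<Rightarrow> 'k pexp \<Rightarrow> (nat \<Rightarrow> 'a) \<Rightarrow> 'a"
  where
    "pval A (Con c) x = c \<odot>\<^bsub>A\<^esub> \<one>\<^bsub>A\<^esub>"
  | "pval A (Var i) x = x i"
  | "pval A (Add e f) x = pval A e x \<oplus>\<^bsub>A\<^esub> pval A f x"
  | "pval A (Mul e f) x = pval A e x \<otimes>\<^bsub>A\<^esub> pval A f x"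

text \<open>The degree is a relation because the zero constant, which ends every sum of terms, has
  all degrees. The notion is syntactic and includes that all constants lie in the carrier.\<close>

primrec homog_pexp :: "('k, 'r) ring_scheme \<Rightarrow> 'k pexp \<Rightarrow> nat \<Rightarrow> bool"
  where
    "homog_pexp k (Con c) d \<longleftrightarrow> c \<in> carrier k \<and> (c = \<zero>\<^bsub>k\<^esub> \<or> d = 0)"
  | "homog_pexp k (Var i) d \<longleftrightarrow> d = 1"
  | "homog_pexp k (Add e f) d \<longleftrightarrow> homog_pexp k e d \<and> homog_pexp k f d"
  | "homog_pexp k (Mul e f) d \<longleftrightarrow> (\<exists>p q. d = p + q \<and> homog_pexp k e p \<and> homog_pexp k f q)"

definition terms_val ::
    "('k, 'a, 'm) module_scheme \<Rightarrow> (nat \<Rightarrow> 'a) \<Rightarrow> ('k \<times> nat multiset) list \<Rightarrow> 'a"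
  where "terms_val A x l = foldr (\<lambda>(c, m) r. c \<odot>\<^bsub>A\<^esub> monom_val A x m \<oplus>\<^bsub>A\<^esub> r) l \<zero>\<^bsub>A\<^esub>"

text \<open>Repeated monomials and zero coefficients stay in the list; they are collected only by
  \<open>poly_of_terms\<close>.\<close>

primrec pexp_terms :: "('k, 'r) ring_scheme \<Rightarrow> 'k pexp \<Rightarrow> ('k \<times> nat multiset) list"
  where
    "pexp_terms k (Con c) = [(c, {#})]"
  | "pexp_terms k (Var i) = [(\<one>\<^bsub>k\<^esub>, {#i#})]"
  | "pexp_terms k (Add e f) = pexp_terms k e @ pexp_terms k f"
  | "pexp_terms k (Mul e f) =
      concat (map (\<lambda>(c, m). map (\<lambda>(d, n). (c \<otimes>\<^bsub>k\<^esub> d, m + n)) (pexp_terms k f)) (pexp_terms k e))"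

text \<open>Folding \<open>indexed_padd\<close>, one of the operations that generate
  \<open>indexed_pset\<close>, makes membership there an induction on the list.\<close>

definition poly_of_terms :: "('k, 'r) ring_scheme \<Rightarrow> ('k \<times> nat multiset) list \<Rightarrow> nat multiset \<Rightarrow> 'k"
  where "poly_of_terms k l =
    foldr (\<lambda>(c, m). ring.indexed_padd k (\<lambda>n. if n = m then c else \<zero>\<^bsub>k\<^esub>)) l (\<lambda>_. \<zero>\<^bsub>k\<^esub>)"

definition pexp_of_monom :: "('k, 'r) ring_scheme \<Rightarrow> nat multiset \<Rightarrow> 'k pexp"
  where "pexp_of_monom k m = foldr (\<lambda>i. Mul (Var i)) (sorted_list_of_multiset m) (Con \<one>\<^bsub>k\<^esub>)"

definition pexp_of_terms :: "('k, 'r) ring_scheme \<Rightarrow> ('k \<times> nat multiset) list \<Rightarrow> 'k pexp"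
  where "pexp_of_terms k l =
    foldr (\<lambda>(c, m). Add (Mul (Con c) (pexp_of_monom k m))) l (Con \<zero>\<^bsub>k\<^esub>)"

lemma terms_val_simps [simp]:
  "terms_val A x [] = \<zero>\<^bsub>A\<^esub>"
  "terms_val A x ((c, m) # l) = c \<odot>\<^bsub>A\<^esub> monom_val A x m \<oplus>\<^bsub>A\<^esub> terms_val A x l"
  by (simp_all add: terms_val_def)

lemma poly_of_terms_simps [simp]:
  "poly_of_terms k [] = (\<lambda>_. \<zero>\<^bsub>k\<^esub>)"
  "poly_of_terms k ((c, m) # l) =
    ring.indexed_padd k (\<lambda>n. if n = m then c else \<zero>\<^bsub>k\<^esub>) (poly_of_terms k l)"
  by (simp_all add: poly_of_terms_def)

lemma pexp_of_terms_simps [simp]: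
  "pexp_of_terms k [] = Con \<zero>\<^bsub>k\<^esub>"
  "pexp_of_terms k ((c, m) # l) = Add (Mul (Con c) (pexp_of_monom k m)) (pexp_of_terms k l)"
  by (simp_all add: pexp_of_terms_def)

section \<open>Values of term lists and of polynomials\<close>

context algebra
begin

lemma monom_val_closed_UNIV:
  assumes "x \<in> UNIV \<rightarrow> carrier M"
  shows "monom_val M x m \<in> carrier M"
  using assms by (intro monom_val_closed) auto

lemma pval_closed [simp, intro]:
  "homog_pexp R e d \<Longrightarrow> x \<in> UNIV \<rightarrow> carrier M \<Longrightarrow> pval M e x \<in> carrier M"
  by (induction e arbitrary: d) auto

lemma pexp_terms_carrier:
  "homog_pexp R e d \<Longrightarrow> set (pexp_terms R e) \<subseteq> carrier R \<times> UNIV"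
  by (induction e arbitrary: d) force+

lemma terms_val_closed:
  assumes "set l \<subseteq> carrier R \<times> UNIV" "x \<in> UNIV \<rightarrow> carrier M"
  shows "terms_val M x l \<in> carrier M"
  using assms by (induction l) (auto intro!: M.add.m_closed smult_closed monom_val_closed_UNIV)

lemma terms_val_append:
  assumes "set l \<subseteq> carrier R \<times> UNIV" "set l' \<subseteq> carrier R \<times> UNIV" "x \<in> UNIV \<rightarrow> carrier M"
  shows "terms_val M x (l @ l') = terms_val M x l \<oplus>\<^bsub>M\<^esub> terms_val M x l'"
  using assms(1)
proof (induction l)
  case Nil
  then show ?case using terms_val_closed[OF assms(2,3)] by simp
next
  case (Cons p l)
  obtain c m where p: "p = (c, m)" by (cases p)
  have "c \<odot>\<^bsub>M\<^esub> monom_val M x m \<in> carrier M"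
    using Cons.prems p assms(3) by (auto intro!: smult_closed monom_val_closed_UNIV)
  moreover have "terms_val M x l \<in> carrier M" "terms_val M x l' \<in> carrier M"
    using Cons.prems assms by (auto intro: terms_val_closed)
  ultimately show ?case using Cons p by (simp add: M.a_assoc)
qed

text \<open>The algebra axiom moves scalars out of the left factor; commutativity does the same for
  the right one.\<close>

lemma smult_mult_distrib:
  assumes "c \<in> carrier R" "d \<in> carrier R" "u \<in> carrier M" "v \<in> carrier M"
  shows "(c \<otimes>\<^bsub>R\<^esub> d) \<odot>\<^bsub>M\<^esub> (u \<otimes>\<^bsub>M\<^esub> v) = (c \<odot>\<^bsub>M\<^esub> u) \<otimes>\<^bsub>M\<^esub> (d \<odot>\<^bsub>M\<^esub> v)"
proof -
  have "(c \<odot>\<^bsub>M\<^esub> u) \<otimes>\<^bsub>M\<^esub> (d \<odot>\<^bsub>M\<^esub> v) = c \<odot>\<^bsub>M\<^esub> (u \<otimes>\<^bsub>M\<^esub> (d \<odot>\<^bsub>M\<^esub> v))"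
    using assms by (simp add: smult_assoc2)
  also have "u \<otimes>\<^bsub>M\<^esub> (d \<odot>\<^bsub>M\<^esub> v) = d \<odot>\<^bsub>M\<^esub> (u \<otimes>\<^bsub>M\<^esub> v)"
    using assms by (metis m_comm smult_assoc2 smult_closed)
  finally show ?thesis using assms by (simp add: smult_assoc1)
qed

lemma terms_val_mult_term:
  assumes "c \<in> carrier R" "set l \<subseteq> carrier R \<times> UNIV" "x \<in> UNIV \<rightarrow> carrier M"
  shows "terms_val M x (map (\<lambda>(d, n). (c \<otimes>\<^bsub>R\<^esub> d, m + n)) l) =
    (c \<odot>\<^bsub>M\<^esub> monom_val M x m) \<otimes>\<^bsub>M\<^esub> terms_val M x l"
  using assms(2)
proof (induction l)
  case Nil
  have "monom_val M x m \<in> carrier M" using assms(3) by (auto intro: monom_val_closed_UNIV)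
  then show ?case using assms by simp
next
  case (Cons p l)
  obtain d n where p: "p = (d, n)" by (cases p)
  have mv: "monom_val M x q \<in> carrier M" for q using assms(3) by (auto intro: monom_val_closed_UNIV)
  have "terms_val M x l \<in> carrier M"
    using Cons.prems assms by (auto intro: terms_val_closed)
  moreover have "monom_val M x (m + n) = monom_val M x m \<otimes>\<^bsub>M\<^esub> monom_val M x n"
    using assms(3) by (intro monom_val_add) auto
  ultimately show ?case using Cons p assms mv by (simp add: smult_mult_distrib r_distr)
qed

lemma terms_val_mult:
  assumes "set l \<subseteq> carrier R \<times> UNIV" "set l' \<subseteq> carrier R \<times> UNIV" "x \<in> UNIV \<rightarrow> carrier M"
  shows "terms_val M x (concat (map (\<lambda>(c, m). map (\<lambda>(d, n). (c \<otimes>\<^bsub>R\<^esub> d, m + n)) l') l)) =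
    terms_val M x l \<otimes>\<^bsub>M\<^esub> terms_val M x l'"
  using assms(1)
proof (induction l)
  case Nil
  then show ?case using terms_val_closed[OF assms(2,3)] by simp
next
  case (Cons p l)
  obtain c m where p: "p = (c, m)" by (cases p)
  have c: "c \<in> carrier R" using Cons.prems p by simp
  have mv: "monom_val M x m \<in> carrier M" using assms(3) by (auto intro: monom_val_closed_UNIV)
  have cl: "terms_val M x l \<in> carrier M" "terms_val M x l' \<in> carrier M"
    using Cons.prems assms by (auto intro: terms_val_closed)
  have "terms_val M x (concat (map (\<lambda>(c, m). map (\<lambda>(d, n). (c \<otimes>\<^bsub>R\<^esub> d, m + n)) l') (p # l))) =
      terms_val M x (map (\<lambda>(d, n). (c \<otimes>\<^bsub>R\<^esub> d, m + n)) l') \<oplus>\<^bsub>M\<^esub>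
      terms_val M x (concat (map (\<lambda>(c, m). map (\<lambda>(d, n). (c \<otimes>\<^bsub>R\<^esub> d, m + n)) l') l))"
    unfolding p list.map concat.simps prod.case
    by (rule terms_val_append) (use Cons.prems assms p in \<open>auto; blast\<close>)+
  also have "\<dots> = (c \<odot>\<^bsub>M\<^esub> monom_val M x m) \<otimes>\<^bsub>M\<^esub> terms_val M x l' \<oplus>\<^bsub>M\<^esub> terms_val M x l \<otimes>\<^bsub>M\<^esub> terms_val M x l'"
    using Cons.IH Cons.prems terms_val_mult_term[OF c assms(2,3)] by simp
  also have "\<dots> = terms_val M x (p # l) \<otimes>\<^bsub>M\<^esub> terms_val M x l'"
    using c mv cl p by (simp add: l_distr)
  finally show ?case .
qed

lemma terms_val_pexp_terms:
  assumes "homog_pexp R e d" "x \<in> UNIV \<rightarrow> carrier M"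
  shows "terms_val M x (pexp_terms R e) = pval M e x"
  using assms(1)
proof (induction e arbitrary: d)
  case (Mul e f)
  then obtain p q where "homog_pexp R e p" "homog_pexp R f q" by auto
  then show ?case using Mul.IH assms(2) by (simp add: terms_val_mult pexp_terms_carrier)
next
  case (Add e f)
  then show ?case using assms(2) by (auto simp: terms_val_append pexp_terms_carrier)
qed (use assms(2) in \<open>auto simp: monom_val_empty monom_val_single Pi_def\<close>)

text \<open>Both sums are extended to the union of the supports, which contains the support of the
  sum even if terms cancel.\<close>

lemma mpoly_eval_add:
  assumes "P \<in> UNIV \<rightarrow> carrier R" "Q \<in> UNIV \<rightarrow> carrier R"
    and "finite {m. P m \<noteq> \<zero>\<^bsub>R\<^esub>}" "finite {m. Q m \<noteq> \<zero>\<^bsub>R\<^esub>}" "x \<in> UNIV \<rightarrow> carrier M"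
  shows "mpoly_eval R M (\<lambda>m. P m \<oplus>\<^bsub>R\<^esub> Q m) x = mpoly_eval R M P x \<oplus>\<^bsub>M\<^esub> mpoly_eval R M Q x"
proof -
  let ?F = "{m. P m \<noteq> \<zero>\<^bsub>R\<^esub>} \<union> {m. Q m \<noteq> \<zero>\<^bsub>R\<^esub>}"
  have fin: "finite ?F" using assms by simp
  have mv: "monom_val M x m \<in> carrier M" for m using assms(5) by (auto intro: monom_val_closed_UNIV)
  have c: "P m \<in> carrier R" "Q m \<in> carrier R" for m using assms by auto
  have "mpoly_eval R M (\<lambda>m. P m \<oplus>\<^bsub>R\<^esub> Q m) x =
      (\<Oplus>\<^bsub>M\<^esub>m\<in>?F. (P m \<oplus>\<^bsub>R\<^esub> Q m) \<odot>\<^bsub>M\<^esub> monom_val M x m)"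
    by (rule mpoly_eval_superset[OF fin _ _ assms(5)]) (use c in auto)
  also have "\<dots> = (\<Oplus>\<^bsub>M\<^esub>m\<in>?F. P m \<odot>\<^bsub>M\<^esub> monom_val M x m \<oplus>\<^bsub>M\<^esub> Q m \<odot>\<^bsub>M\<^esub> monom_val M x m)"
    by (rule M.finsum_cong'[OF refl]) (use c mv in \<open>auto simp: smult_l_distr\<close>)
  also have "\<dots> = (\<Oplus>\<^bsub>M\<^esub>m\<in>?F. P m \<odot>\<^bsub>M\<^esub> monom_val M x m) \<oplus>\<^bsub>M\<^esub> (\<Oplus>\<^bsub>M\<^esub>m\<in>?F. Q m \<odot>\<^bsub>M\<^esub> monom_val M x m)"
    by (rule M.finsum_addf) (use c mv in auto)
  also have "(\<Oplus>\<^bsub>M\<^esub>m\<in>?F. P m \<odot>\<^bsub>M\<^esub> monom_val M x m) = mpoly_eval R M P x"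
    by (rule mpoly_eval_superset[OF fin _ _ assms(5), symmetric]) (use c in auto)
  also have "(\<Oplus>\<^bsub>M\<^esub>m\<in>?F. Q m \<odot>\<^bsub>M\<^esub> monom_val M x m) = mpoly_eval R M Q x"
    by (rule mpoly_eval_superset[OF fin _ _ assms(5), symmetric]) (use c in auto)
  finally show ?thesis .
qed

lemma mpoly_eval_monom:
  assumes "c \<in> carrier R" "x \<in> UNIV \<rightarrow> carrier M"
  shows "mpoly_eval R M (\<lambda>n. if n = m then c else \<zero>\<^bsub>R\<^esub>) x = c \<odot>\<^bsub>M\<^esub> monom_val M x m"
proof -
  have mv: "monom_val M x m \<in> carrier M" using assms(2) by (auto intro: monom_val_closed_UNIV)
  have "mpoly_eval R M (\<lambda>n. if n = m then c else \<zero>\<^bsub>R\<^esub>) x =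
      (\<Oplus>\<^bsub>M\<^esub>n\<in>{m}. (if n = m then c else \<zero>\<^bsub>R\<^esub>) \<odot>\<^bsub>M\<^esub> monom_val M x n)"
    by (rule mpoly_eval_superset[OF _ _ _ assms(2)]) (use assms in auto)
  also have "\<dots> = c \<odot>\<^bsub>M\<^esub> monom_val M x m"
    using assms mv by (subst M.finsum_insert) auto
  finally show ?thesis .
qed

end

section \<open>Polynomials built from term lists\<close>

context ring
begin

text \<open>The monomial grows out of the constant \<open>c\<close> by one multiplication with a
  variable for each element of \<open>m\<close>.\<close>

lemma monom_in_indexed_pset:
  assumes "c \<in> carrier R" "set_mset m \<subseteq> I"
  shows "(\<lambda>n. if n = m then c else \<zero>) \<in> indexed_pset I (carrier R)"
  using assms(2)
proof (induction m)
  case empty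
  then show ?case using indexed_pset.indexed_const[OF assms(1)] by (simp add: indexed_const_def)
next
  case (add i m)
  have "(\<lambda>n. if n = add_mset i m then c else \<zero>) = indexed_pmult (\<lambda>n. if n = m then c else \<zero>) i"
    by (auto simp: indexed_pmult_def fun_eq_iff)
  then show ?case using add by (simp add: indexed_pset.indexed_pmult)
qed

lemma poly_of_terms_in_indexed_pset:
  assumes "\<And>c m. (c, m) \<in> set l \<Longrightarrow> c \<in> carrier R \<and> set_mset m \<subseteq> I"
  shows "poly_of_terms R l \<in> indexed_pset I (carrier R)"
  using assms
proof (induction l)
  case Nil
  then show ?case using indexed_pset.indexed_const[OF zero_closed] by (simp add: indexed_zero_def)
next
  case (Cons p l)
  obtain c m where p: "p = (c, m)" by (cases p)
  show ?case using Cons p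
    by (auto intro!: indexed_pset.indexed_padd monom_in_indexed_pset)
qed

text \<open>Only this implication holds in general, because the coefficients of equal monomials are
  added and may cancel.\<close>

lemma poly_of_terms_nonzeroD:
  "poly_of_terms R l m \<noteq> \<zero> \<Longrightarrow> \<exists>c. c \<noteq> \<zero> \<and> (c, m) \<in> set l"
proof (induction l)
  case (Cons p l)
  obtain c n where p: "p = (c, n)" by (cases p)
  show ?case
  proof (cases "m = n \<and> c \<noteq> \<zero>")
    case True
    then show ?thesis using p by auto
  next
    case False
    then have "poly_of_terms R l m \<noteq> \<zero>"
      using Cons.prems p by (auto simp: indexed_padd_def split: if_splits)
    then show ?thesis using Cons.IH by auto
  qed
qed simp

end

section \<open>Evaluation commutes with the translations\<close>

context algebra
begin

lemma mpoly_eval_poly_of_terms: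
  assumes "set l \<subseteq> carrier R \<times> UNIV" "x \<in> UNIV \<rightarrow> carrier M"
  shows "mpoly_eval R M (poly_of_terms R l) x = terms_val M x l"
  using assms(1)
proof (induction l)
  case Nil
  then show ?case by (simp add: mpoly_eval_eq)
next
  case (Cons p l)
  obtain c m where p: "p = (c, m)" by (cases p)
  have "poly_of_terms R l \<in> ring.indexed_pset R UNIV (carrier R)"
    by (rule R.poly_of_terms_in_indexed_pset) (use Cons.prems in auto)
  note l = R.indexed_pset_support[OF this]
  have "mpoly_eval R M (poly_of_terms R (p # l)) x =
      mpoly_eval R M (\<lambda>n. if n = m then c else \<zero>\<^bsub>R\<^esub>) x \<oplus>\<^bsub>M\<^esub> mpoly_eval R M (poly_of_terms R l) x"
    unfolding p poly_of_terms_simps R.indexed_padd_def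
  proof (rule mpoly_eval_add)
    show "finite {n. (if n = m then c else \<zero>\<^bsub>R\<^esub>) \<noteq> \<zero>\<^bsub>R\<^esub>}"
      by (rule finite_subset[of _ "{m}"]) auto
  qed (use Cons.prems p l(1,2) assms(2) in \<open>simp_all add: Pi_I\<close>)
  then show ?case using Cons p assms(2) by (simp add: mpoly_eval_monom)
qed

lemma pval_pexp_of_monom:
  assumes "x \<in> UNIV \<rightarrow> carrier M"
  shows "pval M (pexp_of_monom R m) x = monom_val M x m"
proof -
  \<comment> \<open>The induction runs over an arbitrary list in place of the sorted enumeration of
    \<open>m\<close>.\<close>
  have "pval M (foldr (\<lambda>i. Mul (Var i)) is (Con \<one>\<^bsub>R\<^esub>)) x = monom_val M x (mset is)" for "is"
  proof (induction "is")
    case (Cons i "is")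
    have "monom_val M x ({#i#} + mset is) = x i \<otimes>\<^bsub>M\<^esub> monom_val M x (mset is)"
      using assms by (subst monom_val_add) (auto simp: monom_val_single Pi_def)
    then show ?case using Cons by simp
  qed (simp add: monom_val_empty)
  from this[of "sorted_list_of_multiset m"] show ?thesis by (simp add: pexp_of_monom_def)
qed

lemma homog_pexp_of_monom: "homog_pexp R (pexp_of_monom R m) (size m)"
proof -
  have "homog_pexp R (foldr (\<lambda>i. Mul (Var i)) is (Con \<one>\<^bsub>R\<^esub>)) (length is)" for "is"
    by (induction "is") (auto intro: exI[of _ "Suc 0"])
  from this[of "sorted_list_of_multiset m"] show ?thesis
    by (metis pexp_of_monom_def mset_sorted_list_of_multiset size_mset)
qed

lemma homog_pexp_of_terms:
  assumes "\<And>c m. (c, m) \<in> set l \<Longrightarrow> c \<in> carrier R \<and> size m = d"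
  shows "homog_pexp R (pexp_of_terms R l) d"
  using assms
proof (induction l)
  case (Cons p l)
  obtain c m where p: "p = (c, m)" by (cases p)
  have "c \<in> carrier R" "size m = d" "homog_pexp R (pexp_of_terms R l) d"
    using Cons p by auto
  then show ?case using homog_pexp_of_monom[of m] p by (auto intro: exI[of _ 0])
qed simp

lemma pval_pexp_of_terms:
  assumes "set l \<subseteq> carrier R \<times> UNIV" "x \<in> UNIV \<rightarrow> carrier M"
  shows "pval M (pexp_of_terms R l) x = terms_val M x l"
  using assms(1)
proof (induction l)
  case (Cons p l)
  obtain c m where p: "p = (c, m)" by (cases p)
  have "monom_val M x m \<in> carrier M" using assms(2) by (auto intro: monom_val_closed_UNIV)
  then show ?case using Cons p assms(2) by (simp add: pval_pexp_of_monom smult_assoc2)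
qed simp

lemma terms_val_eq_finsum:
  assumes "distinct ms" "P \<in> UNIV \<rightarrow> carrier R" "x \<in> UNIV \<rightarrow> carrier M"
  shows "terms_val M x (map (\<lambda>m. (P m, m)) ms) = (\<Oplus>\<^bsub>M\<^esub>m\<in>set ms. P m \<odot>\<^bsub>M\<^esub> monom_val M x m)"
  using assms(1)
proof (induction ms)
  case (Cons m ms)
  have "P n \<odot>\<^bsub>M\<^esub> monom_val M x n \<in> carrier M" for n
    using assms(2,3) by (auto intro: monom_val_closed_UNIV smult_closed)
  then show ?case using Cons by simp
qed simp

end

section \<open>The signature in terms of expressions\<close>

primrec pexp_vars :: "'k pexp \<Rightarrow> nat set"
  where
    "pexp_vars (Con c) = {}"
  | "pexp_vars (Var i) = {i}"
  | "pexp_vars (Add e f) = pexp_vars e \<union> pexp_vars f"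
  | "pexp_vars (Mul e f) = pexp_vars e \<union> pexp_vars f"

lemma finite_pexp_vars [simp]: "finite (pexp_vars e)"
  by (induction e) auto

lemma pval_cong: "(\<And>i. i \<in> pexp_vars e \<Longrightarrow> x i = y i) \<Longrightarrow> pval A e x = pval A e y"
  by (induction e) auto

text \<open>Zero coefficients have no definite degree and are exempted. If a product of coefficients
  is nonzero, so are both factors, and their degrees add up.\<close>

lemma (in ring) pexp_terms_homog:
  "homog_pexp R e d \<Longrightarrow> (c, m) \<in> set (pexp_terms R e) \<Longrightarrow>
    c \<in> carrier R \<and> (c \<noteq> \<zero> \<longrightarrow> size m = d)"
proof (induction e arbitrary: d c m)
  case (Mul e f)
  then obtain p q where d: "d = p + q" "homog_pexp R e p" "homog_pexp R f q" by auto
  from Mul.prems(2) obtain a i b j where ab: "c = a \<otimes> b" "m = i + j"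
    "(a, i) \<in> set (pexp_terms R e)" "(b, j) \<in> set (pexp_terms R f)" by auto
  have "a \<in> carrier R \<and> (a \<noteq> \<zero> \<longrightarrow> size i = p)" "b \<in> carrier R \<and> (b \<noteq> \<zero> \<longrightarrow> size j = q)"
    using Mul.IH d ab by blast+
  then show ?case using d(1) ab(1,2) by auto
qed (auto split: if_splits)

lemma pexp_terms_vars: "(c, m) \<in> set (pexp_terms k e) \<Longrightarrow> set_mset m \<subseteq> pexp_vars e"
  by (induction e arbitrary: c m) (auto, blast+)

text \<open>As in the signature, index \<open>0\<close> is \<open>Y\<close>; but points have a coordinate at every natural number,
  so that variables can be renamed without keeping track of \<open>n\<close>.\<close>

definition signature_pexp :: "('k, 'r) ring_scheme \<Rightarrow> 'k pexp \<Rightarrow> nat \<Rightarrow> bool"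
  where "signature_pexp k e d \<longleftrightarrow> homog_pexp k e d \<and>
    (\<forall>x \<in> UNIV \<rightarrow> carrier k. pval (self_algebra k) e x = \<zero>\<^bsub>k\<^esub> \<longrightarrow> x 0 = \<zero>\<^bsub>k\<^esub>)"

lemma self_algebra_simps [simp]:
  "carrier (self_algebra k) = carrier k"
  "x \<otimes>\<^bsub>self_algebra k\<^esub> y = x \<otimes>\<^bsub>k\<^esub> y"
  "x \<oplus>\<^bsub>self_algebra k\<^esub> y = x \<oplus>\<^bsub>k\<^esub> y"
  "x \<odot>\<^bsub>self_algebra k\<^esub> y = x \<otimes>\<^bsub>k\<^esub> y"
  "\<one>\<^bsub>self_algebra k\<^esub> = \<one>\<^bsub>k\<^esub>"
  "\<zero>\<^bsub>self_algebra k\<^esub> = \<zero>\<^bsub>k\<^esub>"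
  by (simp_all add: self_algebra_def)

text \<open>With this, the results on evaluation in an algebra apply to the evaluation over
  \<open>k\<close> that defines the signature.\<close>

lemma (in cring) algebra_self_algebra: "algebra R (self_algebra R)"
proof (rule algebraI)
  show "cring (self_algebra R)"
  proof (rule cringI)
    show "abelian_group (self_algebra R)"
      by (rule abelian_groupI) (auto simp: a_ac intro: bexI[of _ "\<ominus> _"] l_neg)
    show "Group.comm_monoid (self_algebra R)"
      by (rule comm_monoidI) (auto simp: m_ac)
  qed (auto simp: l_distr)
qed (auto simp: l_distr r_distr m_assoc is_cring)

text \<open>The enumeration of the support is an arbitrary one; it exists because supports are
  finite, and the value does not depend on it.\<close>

definition pexp_of_poly :: "('k, 'r) ring_scheme \<Rightarrow> (nat multiset \<Rightarrow> 'k) \<Rightarrow> 'k pexp"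
  where "pexp_of_poly k P = pexp_of_terms k
    (map (\<lambda>m. (P m, m)) (SOME ms. distinct ms \<and> set ms = {m. P m \<noteq> \<zero>\<^bsub>k\<^esub>}))"

definition poly_of_pexp :: "('k, 'r) ring_scheme \<Rightarrow> 'k pexp \<Rightarrow> nat multiset \<Rightarrow> 'k"
  where "poly_of_pexp k e = poly_of_terms k (pexp_terms k e)"

context algebra
begin

lemma support_list:
  assumes "P \<in> ring.indexed_pset R V (carrier R)"
  shows "distinct (SOME ms. distinct ms \<and> set ms = {m. P m \<noteq> \<zero>\<^bsub>R\<^esub>})"
    and "set (SOME ms. distinct ms \<and> set ms = {m. P m \<noteq> \<zero>\<^bsub>R\<^esub>}) = {m. P m \<noteq> \<zero>\<^bsub>R\<^esub>}"
proof -
  have "\<exists>ms. distinct ms \<and> set ms = {m. P m \<noteq> \<zero>\<^bsub>R\<^esub>}"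
    using finite_distinct_list[OF R.indexed_pset_support(2)[OF assms]] by blast
  from someI_ex[OF this]
  show "distinct (SOME ms. distinct ms \<and> set ms = {m. P m \<noteq> \<zero>\<^bsub>R\<^esub>})"
    and "set (SOME ms. distinct ms \<and> set ms = {m. P m \<noteq> \<zero>\<^bsub>R\<^esub>}) = {m. P m \<noteq> \<zero>\<^bsub>R\<^esub>}" by auto
qed

lemma pval_pexp_of_poly:
  assumes "P \<in> ring.indexed_pset R V (carrier R)" "x \<in> UNIV \<rightarrow> carrier M"
  shows "pval M (pexp_of_poly R P) x = mpoly_eval R M P x"
  unfolding pexp_of_poly_def
  using R.indexed_pset_support(1)[OF assms(1)] support_list[OF assms(1)] assms(2)
  by (subst pval_pexp_of_terms) (auto simp: terms_val_eq_finsum mpoly_eval_eq)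

lemma homog_pexp_of_poly:
  assumes "P \<in> ring.indexed_pset R V (carrier R)" "\<And>m. P m \<noteq> \<zero>\<^bsub>R\<^esub> \<Longrightarrow> size m = d"
  shows "homog_pexp R (pexp_of_poly R P) d"
  unfolding pexp_of_poly_def
  by (rule homog_pexp_of_terms)
    (use R.indexed_pset_support(1)[OF assms(1)] support_list(2)[OF assms(1)] assms(2) in auto)

lemma mpoly_eval_poly_of_pexp:
  assumes "homog_pexp R e d" "x \<in> UNIV \<rightarrow> carrier M"
  shows "mpoly_eval R M (poly_of_pexp R e) x = pval M e x"
  using assms by (simp add: poly_of_pexp_def mpoly_eval_poly_of_terms pexp_terms_carrier
      terms_val_pexp_terms)

text \<open>Padding with zeros beyond \<open>n\<close> puts every coordinate into the carrier, as
  the results on expressions require, and touches no variable of \<open>P\<close>.\<close>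

lemma mpoly_eval_extend:
  assumes "P \<in> ring.indexed_pset R {0..n} (carrier R)" "a \<in> {1..n} \<rightarrow> carrier M" "b \<in> carrier M"
  shows "mpoly_eval R M P (a(0 := b)) = mpoly_eval R M P (\<lambda>i. if i \<le> n then (a(0 := b)) i else \<zero>\<^bsub>M\<^esub>)"
proof (rule mpoly_eval_cong[where V = "{0..n}"])
  show "(\<lambda>i. if i \<le> n then (a(0 := b)) i else \<zero>\<^bsub>M\<^esub>) \<in> {0..n} \<rightarrow> carrier M"
    using assms(2,3) by (auto simp: Pi_def Suc_le_eq)
qed (use R.indexed_pset_support[OF assms(1)] in auto)

lemma extend_closed:
  fixes n :: nat
  assumes "a \<in> {1..n} \<rightarrow> carrier M" "b \<in> carrier M"
  shows "(\<lambda>i. if i \<le> n then (a(0 := b)) i else \<zero>\<^bsub>M\<^esub>) \<in> UNIV \<rightarrow> carrier M"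
  using assms by (auto simp: Pi_def Suc_le_eq)

end

lemma homogeneous_signature_to_pexp:
  assumes "field k" "(n, P) \<in> homogeneous_signature k"
  shows "\<exists>d. signature_pexp k (pexp_of_poly k P) d"
proof -
  interpret k: field k by fact
  interpret K: algebra k "self_algebra k" by (rule k.algebra_self_algebra)
  from assms(2) obtain d where P: "P \<in> ring.indexed_pset k {0..n} (carrier k)"
    and d: "\<And>m. P m \<noteq> \<zero>\<^bsub>k\<^esub> \<Longrightarrow> size m = d"
    and z: "\<And>a b. a \<in> {1..n} \<rightarrow> carrier k \<Longrightarrow> b \<in> carrier k \<Longrightarrow>
      mpoly_eval k (self_algebra k) P (a(0 := b)) = \<zero>\<^bsub>k\<^esub> \<Longrightarrow> b = \<zero>\<^bsub>k\<^esub>"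
    unfolding homogeneous_signature_def homogeneous_def by auto
  \<comment> \<open>With \<open>a = x\<close> and \<open>b = x 0\<close> the signature condition
    speaks of \<open>x\<close> itself, since \<open>x(0 := x 0) = x\<close>.\<close>
  have "x 0 = \<zero>\<^bsub>k\<^esub>"
    if x: "x \<in> UNIV \<rightarrow> carrier k" and "pval (self_algebra k) (pexp_of_poly k P) x = \<zero>\<^bsub>k\<^esub>" for x
    using z[of x "x 0"] K.pval_pexp_of_poly[OF P, of x] that by auto
  then show ?thesis
    using K.homog_pexp_of_poly[OF P d] unfolding signature_pexp_def by blast
qed

lemma signature_pexp_to_poly:
  assumes "field k" "signature_pexp k e d" "pexp_vars e \<subseteq> {0..n}"
  shows "(n, poly_of_pexp k e) \<in> homogeneous_signature k"
proof -
  interpret k: field k by fact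
  interpret K: algebra k "self_algebra k" by (rule k.algebra_self_algebra)
  let ?P = "poly_of_pexp k e"
  have h: "homog_pexp k e d"
    and z: "\<And>x. x \<in> UNIV \<rightarrow> carrier k \<Longrightarrow> pval (self_algebra k) e x = \<zero>\<^bsub>k\<^esub> \<Longrightarrow> x 0 = \<zero>\<^bsub>k\<^esub>"
    using assms(2) unfolding signature_pexp_def by blast+
  have P: "?P \<in> ring.indexed_pset k {0..n} (carrier k)"
    unfolding poly_of_pexp_def
    by (rule k.poly_of_terms_in_indexed_pset)
      (use k.pexp_terms_homog[OF h] pexp_terms_vars[of _ _ k e] assms(3) in blast)
  have "size m = d" if "?P m \<noteq> \<zero>\<^bsub>k\<^esub>" for m
    using k.poly_of_terms_nonzeroD[of "pexp_terms k e" m] k.pexp_terms_homog[OF h] that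
    unfolding poly_of_pexp_def by blast
  then have "homogeneous k ?P" unfolding homogeneous_def by blast
  \<comment> \<open>At the point whose coordinates are all 1, a zero polynomial would vanish, and
    the signature condition would give 1 = 0 in a field.\<close>
  moreover have "?P \<noteq> (\<lambda>m. \<zero>\<^bsub>k\<^esub>)"
  proof
    assume "?P = (\<lambda>m. \<zero>\<^bsub>k\<^esub>)"
    then have "pval (self_algebra k) e (\<lambda>_. \<one>\<^bsub>k\<^esub>) = \<zero>\<^bsub>k\<^esub>"
      using K.mpoly_eval_poly_of_pexp[OF h, of "\<lambda>_. \<one>\<^bsub>k\<^esub>"] by (simp add: mpoly_eval_eq)
    then show False using z[of "\<lambda>_. \<one>\<^bsub>k\<^esub>"] by simp
  qed
  moreover have "b = \<zero>\<^bsub>k\<^esub>" if ab: "a \<in> {1..n} \<rightarrow> carrier k" "b \<in> carrier k"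
    "mpoly_eval k (self_algebra k) ?P (a(0 := b)) = \<zero>\<^bsub>k\<^esub>" for a b
  proof -
    let ?y = "\<lambda>i. if i \<le> n then (a(0 := b)) i else \<zero>\<^bsub>k\<^esub>"
    have "?y \<in> UNIV \<rightarrow> carrier k" using K.extend_closed[of a n b, unfolded self_algebra_simps] ab by blast
    then show ?thesis
      using z[of ?y] K.mpoly_eval_extend[OF P, of a b, unfolded self_algebra_simps] K.mpoly_eval_poly_of_pexp[OF h, of ?y] ab by simp
  qed
  ultimately show ?thesis using P unfolding homogeneous_signature_def by auto
qed

text \<open>The translations preserve the signature and all values, so polynomials with a recorded
  \<open>n\<close> can be exchanged for expressions with points on all natural numbers.\<close>

lemma special_ideal_iff_pexp:
  assumes "field k" "algebra k A"
  shows "special_ideal k A J \<longleftrightarrow> ideal J A \<and>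
    (\<forall>e d. \<forall>x \<in> UNIV \<rightarrow> carrier A. signature_pexp k e d \<longrightarrow> pval A e x \<in> J \<longrightarrow> x 0 \<in> J)"
    (is "_ \<longleftrightarrow> _ \<and> ?R")
proof -
  interpret A: algebra k A by fact
  show ?thesis
  proof (intro iffI conjI allI ballI impI)
    assume "special_ideal k A J"
    then show "ideal J A" by (simp add: special_ideal_def)
  next
    fix e d x
    assume J: "special_ideal k A J" and x: "x \<in> UNIV \<rightarrow> carrier A" and e: "signature_pexp k e d"
      and v: "pval A e x \<in> J"
    \<comment> \<open>The inserted 0 keeps the maximum meaningful when no variable occurs.\<close>
    define n where "n = Max (insert 0 (pexp_vars e))"
    have "pexp_vars e \<subseteq> {0..n}" by (auto simp: n_def)
    note P = signature_pexp_to_poly[OF assms(1) e this]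
    have "mpoly_eval k A (poly_of_pexp k e) (x(0 := x 0)) = pval A e x"
      using e A.mpoly_eval_poly_of_pexp[of e d x] x by (simp add: signature_pexp_def)
    moreover have "x \<in> {1..n} \<rightarrow> carrier A" "x 0 \<in> carrier A" using x by auto
    ultimately show "x 0 \<in> J"
      using J P v unfolding special_ideal_def by fastforce
  next
    assume J: "ideal J A \<and> ?R"
    show "special_ideal k A J"
      unfolding special_ideal_def
    proof (intro conjI ballI impI, goal_cases)
      case 1
      then show ?case using J by simp
    next
      case (2 nP)
      obtain n P where nP: "nP = (n, P)" by (cases nP)
      have "b \<in> J" if ab: "a \<in> {1..n} \<rightarrow> carrier A" "b \<in> carrier A" "mpoly_eval k A P (a(0 := b)) \<in> J" for a b
      proof -
        let ?y = "\<lambda>i. if i \<le> n then (a(0 := b)) i else \<zero>\<^bsub>A\<^esub>"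
        have y: "?y \<in> UNIV \<rightarrow> carrier A" using A.extend_closed ab by blast
        have P: "P \<in> ring.indexed_pset k {0..n} (carrier k)"
          using 2 nP unfolding homogeneous_signature_def by simp
        have "pval A (pexp_of_poly k P) ?y \<in> J"
          using A.mpoly_eval_extend[OF P ab(1,2)] A.pval_pexp_of_poly[OF P y] ab(3) by simp
        moreover obtain d where "signature_pexp k (pexp_of_poly k P) d"
          using homogeneous_signature_to_pexp assms(1) 2 nP by blast
        ultimately have "?y 0 \<in> J" using J y by blast
        then show ?thesis by simp
      qed
      then show ?case using nP by simp
    qed
  qed
qed

section \<open>Operations on the signature\<close>

primrec pexp_subst :: "(nat \<Rightarrow> 'k pexp) \<Rightarrow> 'k pexp \<Rightarrow> 'k pexp"
  where
    "pexp_subst \<sigma> (Con c) = Con c"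
  | "pexp_subst \<sigma> (Var i) = \<sigma> i"
  | "pexp_subst \<sigma> (Add e f) = Add (pexp_subst \<sigma> e) (pexp_subst \<sigma> f)"
  | "pexp_subst \<sigma> (Mul e f) = Mul (pexp_subst \<sigma> e) (pexp_subst \<sigma> f)"

primrec pexp_power :: "('k, 'r) ring_scheme \<Rightarrow> 'k pexp \<Rightarrow> nat \<Rightarrow> 'k pexp"
  where
    "pexp_power k e 0 = Con \<one>\<^bsub>k\<^esub>"
  | "pexp_power k e (Suc n) = Mul e (pexp_power k e n)"

lemma pval_subst: "pval A (pexp_subst \<sigma> e) x = pval A e (\<lambda>i. pval A (\<sigma> i) x)"
  by (induction e) auto

text \<open>Every variable of degree 1 becomes an expression of degree \<open>r\<close>, so degrees
  multiply. All \<open>\<sigma> i\<close> must share this \<open>r\<close>, which later forces some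
  of them to be padded.\<close>

lemma homog_pexp_subst:
  assumes "\<And>i. homog_pexp k (\<sigma> i) r" "homog_pexp k e d"
  shows "homog_pexp k (pexp_subst \<sigma> e) (d * r)"
  using assms(2)
proof (induction e arbitrary: d)
  case (Mul e f)
  then show ?case by (auto simp: add_mult_distrib) blast
qed (use assms(1) in auto)

lemma homog_pexp_rename:
  assumes "homog_pexp k e d"
  shows "homog_pexp k (pexp_subst (\<lambda>i. Var (f i)) e) d"
  using homog_pexp_subst[of k "\<lambda>i. Var (f i)" 1 e d] assms by simp

lemma (in ring) homog_pexp_power_Var: "homog_pexp R (pexp_power R (Var i) n) n"
  by (induction n) (auto intro: exI[of _ "Suc 0"])

lemma signature_pexpD:
  assumes "signature_pexp k e d"
  shows "homog_pexp k e d"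
    and "x \<in> UNIV \<rightarrow> carrier k \<Longrightarrow> pval (self_algebra k) e x = \<zero>\<^bsub>k\<^esub> \<Longrightarrow> x 0 = \<zero>\<^bsub>k\<^esub>"
  using assms unfolding signature_pexp_def by blast+

section \<open>Homogeneous scaling and congruence modulo an ideal\<close>

context algebra
begin

lemma pval_power_one:
  assumes "x i = \<one>\<^bsub>M\<^esub>"
  shows "pval M (pexp_power R (Var i) n) x = \<one>\<^bsub>M\<^esub>"
  using assms by (induction n) auto

text \<open>Homogeneity enters here: each monomial of degree \<open>d\<close> contributes
  \<open>d\<close> factors \<open>t\<close>. It serves to show that the maximal ideal is special and
  to clear the factor \<open>w\<close> in the localization.\<close>

lemma pval_scale:
  assumes "homog_pexp R e d" "x \<in> UNIV \<rightarrow> carrier M" "t \<in> carrier M"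
  shows "pval M e (\<lambda>i. t \<otimes>\<^bsub>M\<^esub> x i) = t [^]\<^bsub>M\<^esub> d \<otimes>\<^bsub>M\<^esub> pval M e x"
  using assms(1)
proof (induction e arbitrary: d)
  case (Con c)
  then show ?case using assms(3) by auto
next
  case (Var i)
  then show ?case using assms(3) by simp
next
  case (Add e f)
  then have "pval M e x \<in> carrier M" "pval M f x \<in> carrier M" using assms(2) by auto
  then show ?case using Add.IH[of d] Add.prems assms(3) by (simp add: r_distr)
next
  case (Mul e f)
  then obtain p q where d: "d = p + q" "homog_pexp R e p" "homog_pexp R f q" by auto
  then have "pval M e x \<in> carrier M" "pval M f x \<in> carrier M" using assms(2) by auto
  then show ?case
    using Mul.IH(1)[OF d(2)] Mul.IH(2)[OF d(3)] d(1) assms(3) by (simp add: nat_pow_mult[symmetric] m_ac)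
qed

text \<open>Polynomial maps respect congruence modulo an ideal, because sums and products
  do.\<close>

lemma pval_diff_in_ideal:
  assumes "ideal J M" "homog_pexp R e d" "x \<in> UNIV \<rightarrow> carrier M" "y \<in> UNIV \<rightarrow> carrier M"
    and "\<And>i. x i \<ominus>\<^bsub>M\<^esub> y i \<in> J"
  shows "pval M e x \<ominus>\<^bsub>M\<^esub> pval M e y \<in> J"
  using assms(2)
proof (induction e arbitrary: d)
  case (Con c)
  then show ?case
    using additive_subgroup.zero_closed[OF ideal.axioms(1)[OF assms(1)]]
    by (simp add: a_minus_def M.r_neg)
next
  case (Var i)
  then show ?case using assms(5) by simp
next
  case (Add e f)
  then have cl: "pval M e x \<in> carrier M" "pval M f x \<in> carrier M"
    "pval M e y \<in> carrier M" "pval M f y \<in> carrier M" using assms(3,4) by auto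
  have "(pval M e x \<ominus>\<^bsub>M\<^esub> pval M e y) \<oplus>\<^bsub>M\<^esub> (pval M f x \<ominus>\<^bsub>M\<^esub> pval M f y) \<in> J"
    using Add additive_subgroup.a_closed[OF ideal.axioms(1)[OF assms(1)]] by auto
  moreover have "(pval M e x \<ominus>\<^bsub>M\<^esub> pval M e y) \<oplus>\<^bsub>M\<^esub> (pval M f x \<ominus>\<^bsub>M\<^esub> pval M f y) =
    (pval M e x \<oplus>\<^bsub>M\<^esub> pval M f x) \<ominus>\<^bsub>M\<^esub> (pval M e y \<oplus>\<^bsub>M\<^esub> pval M f y)"
    using cl by (simp add: a_minus_def M.minus_add M.a_ac)
  ultimately show ?case by simp
next
  case (Mul e f)
  then obtain p q where d: "homog_pexp R e p" "homog_pexp R f q" by auto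
  then have cl: "pval M e x \<in> carrier M" "pval M f x \<in> carrier M"
    "pval M e y \<in> carrier M" "pval M f y \<in> carrier M" using assms(3,4) by auto
  \<comment> \<open>The product case rests on
    \<open>u v - u' v' = u (v - v') + (u - u') v'\<close>.\<close>
  have "pval M e x \<otimes>\<^bsub>M\<^esub> (pval M f x \<ominus>\<^bsub>M\<^esub> pval M f y) \<oplus>\<^bsub>M\<^esub> (pval M e x \<ominus>\<^bsub>M\<^esub> pval M e y) \<otimes>\<^bsub>M\<^esub> pval M f y \<in> J"
    using Mul.IH d cl by (intro additive_subgroup.a_closed[OF ideal.axioms(1)[OF assms(1)]]
        ideal.I_l_closed[OF assms(1)] ideal.I_r_closed[OF assms(1)])
  moreover have "pval M e x \<otimes>\<^bsub>M\<^esub> (pval M f x \<ominus>\<^bsub>M\<^esub> pval M f y) \<oplus>\<^bsub>M\<^esub> (pval M e x \<ominus>\<^bsub>M\<^esub> pval M e y) \<otimes>\<^bsub>M\<^esub> pval M f y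
    = pval M e x \<otimes>\<^bsub>M\<^esub> pval M f x \<ominus>\<^bsub>M\<^esub> pval M e y \<otimes>\<^bsub>M\<^esub> pval M f y"
  proof -
    have "\<ominus>\<^bsub>M\<^esub> (pval M e x \<otimes>\<^bsub>M\<^esub> pval M f y) \<oplus>\<^bsub>M\<^esub> (pval M e x \<otimes>\<^bsub>M\<^esub> pval M f y \<oplus>\<^bsub>M\<^esub>
        \<ominus>\<^bsub>M\<^esub> (pval M e y \<otimes>\<^bsub>M\<^esub> pval M f y)) = \<ominus>\<^bsub>M\<^esub> (pval M e y \<otimes>\<^bsub>M\<^esub> pval M f y)"
      using cl by (simp add: M.a_assoc[symmetric] M.l_neg)
    then show ?thesis
      using cl by (simp add: a_minus_def r_distr l_distr r_minus l_minus M.a_assoc)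
  qed
  ultimately show ?case by simp
qed

end

text \<open>Since \<open>k\<close> has no zero divisors, a zero of \<open>Y P\<close> has
  \<open>Y = 0\<close> either directly or through \<open>P\<close>. The extra factor makes the
  degree positive, as \<open>signature_values\<close> demands.\<close>

lemma signature_pexp_mult_Var:
  assumes "field k" "signature_pexp k e d"
  shows "signature_pexp k (Mul (Var 0) e) (Suc d)"
proof -
  interpret k: field k by fact
  interpret K: algebra k "self_algebra k" by (rule k.algebra_self_algebra)
  have "v 0 = \<zero>\<^bsub>k\<^esub>" if v: "v \<in> UNIV \<rightarrow> carrier k"
    and z: "v 0 \<otimes>\<^bsub>k\<^esub> pval (self_algebra k) e v = \<zero>\<^bsub>k\<^esub>" for v
  proof -
    have "pval (self_algebra k) e v \<in> carrier k" "v 0 \<in> carrier k"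
      using K.pval_closed[OF signature_pexpD(1)[OF assms(2)], of v] v by auto
    then show ?thesis
      using z k.integral signature_pexpD(2)[OF assms(2) v] by blast
  qed
  then show ?thesis
    using assms(2) unfolding signature_pexp_def by auto
qed

text \<open>Only positive degrees are used: then \<open>u P(a, b) \<in> I\<close> implies \<open>P(u a, u b) = u\<^sup>d P(a, b) \<in> I\<close>.\<close>

definition signature_values :: "('k, 'r) ring_scheme \<Rightarrow> ('k, 'a, 'm) module_scheme \<Rightarrow> 'a \<Rightarrow> 'a set"
  where "signature_values k A b =
    {pval A e x | e d x. signature_pexp k e (Suc d) \<and> x \<in> UNIV \<rightarrow> carrier A \<and> x 0 = b}"

lemma signature_valuesI:
  "signature_pexp k e (Suc d) \<Longrightarrow> x \<in> UNIV \<rightarrow> carrier A \<Longrightarrow> x 0 = b \<Longrightarrow> pval A e x = r \<Longrightarrow>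
    r \<in> signature_values k A b"
  unfolding signature_values_def by blast

lemma signature_valuesE:
  assumes "r \<in> signature_values k A b"
  obtains e d x where "signature_pexp k e (Suc d)" "x \<in> UNIV \<rightarrow> carrier A" "x 0 = b" "r = pval A e x"
  using assms unfolding signature_values_def by blast

text \<open>The certificate is the polynomial \<open>Y\<close>, of degree
  \<open>Suc 0\<close>.\<close>

lemma signature_values_self: "b \<in> carrier A \<Longrightarrow> b \<in> signature_values k A b"
  by (rule signature_valuesI[of _ "Var 0" 0 "\<lambda>_. b"]) (auto simp: signature_pexp_def)

text \<open>Over a field a product vanishes only if a factor does, and either factor then forces
  \<open>Y\<close> to vanish. The two polynomials share \<open>Y\<close>, and their other variables
  are kept apart.\<close>

lemma signature_values_mult:
  assumes "field k" "r \<in> signature_values k A b" "s \<in> signature_values k A b"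
  shows "r \<otimes>\<^bsub>A\<^esub> s \<in> signature_values k A b"
proof -
  interpret k: field k by fact
  interpret K: algebra k "self_algebra k" by (rule k.algebra_self_algebra)
  obtain e d x where e: "signature_pexp k e (Suc d)" and x: "x \<in> UNIV \<rightarrow> carrier A" "x 0 = b"
    and r: "r = pval A e x" using assms(2) by (rule signature_valuesE)
  obtain f p y where f: "signature_pexp k f (Suc p)" and y: "y \<in> UNIV \<rightarrow> carrier A" "y 0 = b"
    and s: "s = pval A f y" using assms(3) by (rule signature_valuesE)
  \<comment> \<open>Even indices go to \<open>e\<close> and odd ones to \<open>f\<close>; both
    renamings fix 0, so \<open>Y\<close> is shared.\<close>
  let ?e = "pexp_subst (\<lambda>i. Var (2 * i)) e"
  let ?f = "pexp_subst (\<lambda>i. Var (if i = 0 then 0 else 2 * i + 1)) f"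
  \<comment> \<open>Halving undoes both renamings, so \<open>?z\<close> restricts to
    \<open>x\<close> on the variables of \<open>?e\<close> and to \<open>y\<close> on those of
    \<open>?f\<close>.\<close>
  let ?z = "\<lambda>j. if j = 0 then b else if even j then x (j div 2) else y (j div 2)"
  show ?thesis
  proof (rule signature_valuesI)
    have h: "homog_pexp k ?e (Suc d)" "homog_pexp k ?f (Suc p)"
      by (intro homog_pexp_rename signature_pexpD(1) e f)+
    have "v 0 = \<zero>\<^bsub>k\<^esub>" if v: "v \<in> UNIV \<rightarrow> carrier k" and "pval (self_algebra k) (Mul ?e ?f) v = \<zero>\<^bsub>k\<^esub>" for v
    proof -
      have cl: "pval (self_algebra k) ?e v \<in> carrier k" "pval (self_algebra k) ?f v \<in> carrier k"
        using K.pval_closed[OF h(1), of v] K.pval_closed[OF h(2), of v] v by simp_all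
      have "pval (self_algebra k) ?e v \<otimes>\<^bsub>k\<^esub> pval (self_algebra k) ?f v = \<zero>\<^bsub>k\<^esub>"
        using that(2) by (simp only: pval.simps self_algebra_simps)
      from k.integral[OF this cl] show ?thesis
      proof
        assume 1: "pval (self_algebra k) ?e v = \<zero>\<^bsub>k\<^esub>"
        show ?thesis
          using signature_pexpD(2)[OF e, of "\<lambda>i. v (2 * i)"] v 1 by (simp add: pval_subst Pi_def)
      next
        assume 2: "pval (self_algebra k) ?f v = \<zero>\<^bsub>k\<^esub>"
        have "(\<lambda>i. v (if i = 0 then 0 else 2 * i + 1)) \<in> UNIV \<rightarrow> carrier k" using v by auto
        from signature_pexpD(2)[OF f this] 2 show ?thesis
          unfolding pval_subst pval.simps by simp
      qed
    qed
    moreover have "homog_pexp k (Mul ?e ?f) (Suc (d + Suc p))"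
      unfolding homog_pexp.simps using h by (intro exI[of _ "Suc d"] exI[of _ "Suc p"]) simp
    ultimately show "signature_pexp k (Mul ?e ?f) (Suc (d + Suc p))"
      unfolding signature_pexp_def by blast
    show "?z \<in> UNIV \<rightarrow> carrier A" using x y by (auto simp: Pi_def)
    have "(\<lambda>i. ?z (2 * i)) = x" "(\<lambda>i. ?z (if i = 0 then 0 else 2 * i + 1)) = y"
      using x(2) y(2) by (auto simp: fun_eq_iff)
    then show "pval A (Mul ?e ?f) ?z = r \<otimes>\<^bsub>A\<^esub> s"
      unfolding pval.simps pval_subst r s by simp
  qed simp
qed

text \<open>For \<open>P(X\<^sub>1, \<dots>, X\<^sub>n, R(Z, Y))\<close> to be homogeneous, each \<open>X\<^sub>i\<close> is multiplied by a power of a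
  further variable, evaluated at \<open>1\<close>, that raises its degree to the degree of \<open>R\<close>.\<close>

lemma signature_values_compose:
  assumes "field k" "algebra k A" "r \<in> signature_values k A b"
    and "signature_pexp k f (Suc p)" "y \<in> UNIV \<rightarrow> carrier A" "y 0 = r"
  shows "pval A f y \<in> signature_values k A b"
proof -
  interpret k: field k by fact
  interpret K: algebra k "self_algebra k" by (rule k.algebra_self_algebra)
  interpret A: algebra k A by fact
  obtain e d x where e: "signature_pexp k e (Suc d)" and x: "x \<in> UNIV \<rightarrow> carrier A" "x 0 = b"
    and r: "r = pval A e x" using assms(3) by (rule signature_valuesE)
  let ?e = "pexp_subst (\<lambda>i. Var (2 * i)) e"
  \<comment> \<open>Even indices carry the variables of \<open>e\<close>. Those of \<open>f\<close>
    other than \<open>Y\<close> move to odd indices from 3 on, which leaves 1 for the padding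
    variable; its power \<open>d\<close> raises their degree to \<open>Suc d\<close>, the degree of
    \<open>?e\<close>.\<close>
  let ?\<sigma> = "\<lambda>i. if i = 0 then ?e else Mul (Var (2 * i + 1)) (pexp_power k (Var 1) d)"
  let ?z = "\<lambda>j. if j = 0 then b else if j = 1 then \<one>\<^bsub>A\<^esub> else if even j then x (j div 2) else y (j div 2)"
  show ?thesis
  proof (rule signature_valuesI)
    have he: "homog_pexp k ?e (Suc d)"
      by (intro homog_pexp_rename signature_pexpD(1) e)
    have h\<sigma>: "homog_pexp k (?\<sigma> i) (Suc d)" for i
      using he k.homog_pexp_power_Var[of 1 d] by (auto intro: exI[of _ 1])
    have h: "homog_pexp k (pexp_subst ?\<sigma> f) (Suc p * Suc d)"
      by (rule homog_pexp_subst[OF h\<sigma>]) (rule signature_pexpD(1)[OF assms(4)])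
    have "v 0 = \<zero>\<^bsub>k\<^esub>" if v: "v \<in> UNIV \<rightarrow> carrier k"
      and "pval (self_algebra k) (pexp_subst ?\<sigma> f) v = \<zero>\<^bsub>k\<^esub>" for v
    proof -
      have "pval (self_algebra k) f (\<lambda>i. pval (self_algebra k) (?\<sigma> i) v) = \<zero>\<^bsub>k\<^esub>"
        using that by (simp only: pval_subst)
      moreover have "(\<lambda>i. pval (self_algebra k) (?\<sigma> i) v) \<in> UNIV \<rightarrow> carrier k"
        using K.pval_closed[OF h\<sigma>, of v] v by (simp only: self_algebra_simps) blast
      \<comment> \<open>The condition is applied twice: for \<open>f\<close> it makes the expression
        in place of \<open>Y\<close> vanish, and for \<open>e\<close> it then makes \<open>Y\<close>
        itself vanish.\<close>
      ultimately have "pval (self_algebra k) (?\<sigma> 0) v = \<zero>\<^bsub>k\<^esub>"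
        by (rule signature_pexpD(2)[OF assms(4), rotated])
      moreover have "(\<lambda>i. v (2 * i)) \<in> UNIV \<rightarrow> carrier k" using v by auto
      ultimately show ?thesis
        using signature_pexpD(2)[OF e, of "\<lambda>i. v (2 * i)"] by (simp add: pval_subst)
    qed
    then show "signature_pexp k (pexp_subst ?\<sigma> f) (Suc (d + p * Suc d))"
      using h unfolding signature_pexp_def by (simp add: ac_simps)
    show "?z \<in> UNIV \<rightarrow> carrier A" using x assms(5) by (auto simp: Pi_def)
    have 1: "(\<lambda>i. ?z (2 * i)) = x" using x(2) by (auto simp: fun_eq_iff)
    have "pval A (?\<sigma> i) ?z = y i" for i
    proof (cases "i = 0")
      case True
      then show ?thesis using 1 r assms(6) by (simp add: pval_subst del: mult_eq_0_iff)
    next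
      case False
      then show ?thesis using assms(5) by (simp add: A.pval_power_one Pi_def)
    qed
    then show "pval A (pexp_subst ?\<sigma> f) ?z = pval A f y"
      unfolding pval_subst by presburger
  qed simp
qed

section \<open>Certificates for the special radical\<close>

text \<open>Zorn's lemma applies because the union of a nonempty chain of ideals avoiding
  \<open>D\<close> is again such an ideal. The last conclusion is maximality, read off
  elementwise.\<close>

lemma (in cring) ideal_maximal_avoiding:
  assumes "ideal I R" "I \<inter> D = {}"
  obtains Q where "ideal Q R" "I \<subseteq> Q" "Q \<inter> D = {}"
    and "\<And>c. c \<in> carrier R \<Longrightarrow> c \<notin> Q \<Longrightarrow> \<exists>q\<in>Q. \<exists>f\<in>carrier R. q \<oplus> f \<otimes> c \<in> D"
proof -
  let ?A = "{Q. ideal Q R \<and> I \<subseteq> Q \<and> Q \<inter> D = {}}"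
  have "\<exists>Q\<in>?A. \<forall>J\<in>?A. Q \<subseteq> J \<longrightarrow> J = Q"
  proof (rule subset_Zorn_nonempty)
    show "?A \<noteq> {}" using assms by auto
    fix C assume C: "C \<noteq> {}" "subset.chain ?A C"
    have sub: "\<And>Q. Q \<in> C \<Longrightarrow> ideal Q R \<and> I \<subseteq> Q \<and> Q \<inter> D = {}"
      and lin: "\<And>P Q. P \<in> C \<Longrightarrow> Q \<in> C \<Longrightarrow> P \<subseteq> Q \<or> Q \<subseteq> P"
      using C(2) unfolding subset_chain_def by blast+
    have "ideal (\<Union>C) R"
    proof (rule idealI[OF ring_axioms])
      show "subgroup (\<Union>C) (add_monoid R)"
      proof (rule add.subgroupI)
        show "\<Union>C \<subseteq> carrier R"
        proof
          fix a assume "a \<in> \<Union>C"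
          then obtain P where "P \<in> C" "a \<in> P" by blast
          then show "a \<in> carrier R" using ideal.Icarr[of P R a] sub by simp
        qed
        obtain P where "P \<in> C" using C(1) by blast
        then have "\<zero> \<in> P"
          using additive_subgroup.zero_closed[OF ideal.axioms(1), of P R] sub by simp
        then show "\<Union>C \<noteq> {}" using \<open>P \<in> C\<close> by blast
      next
        fix a assume "a \<in> \<Union>C"
        then obtain P where "P \<in> C" "a \<in> P" by blast
        moreover from this have "\<ominus> a \<in> P"
          using additive_subgroup.a_inv_closed[OF ideal.axioms(1), of P R a] sub by simp
        ultimately show "\<ominus> a \<in> \<Union>C" by blast
      next
        fix a b assume "a \<in> \<Union>C" "b \<in> \<Union>C"
        then obtain P where P: "P \<in> C" "a \<in> P" "b \<in> P" using lin by blast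
        then have "a \<oplus> b \<in> P"
          using additive_subgroup.a_closed[OF ideal.axioms(1), of P R a b] sub by simp
        then show "a \<oplus> b \<in> \<Union>C" using P(1) by blast
      qed
    next
      fix a u assume "a \<in> \<Union>C" "u \<in> carrier R"
      moreover from this obtain P where "P \<in> C" "a \<in> P" by blast
      ultimately have "P \<in> C" "u \<otimes> a \<in> P" "a \<otimes> u \<in> P"
        using sub ideal.I_l_closed[of P R a u] ideal.I_r_closed[of P R a u] by auto
      then show "u \<otimes> a \<in> \<Union>C" "a \<otimes> u \<in> \<Union>C" by auto
    qed
    moreover have "I \<subseteq> \<Union>C" "\<Union>C \<inter> D = {}" using C(1) sub by blast+
    ultimately show "\<Union>C \<in> ?A" by blast
  qed
  then obtain Q where QA: "Q \<in> ?A" and QJ: "\<forall>J\<in>?A. Q \<subseteq> J \<longrightarrow> J = Q"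
    by (elim bexE)
  have Q: "ideal Q R" "I \<subseteq> Q" "Q \<inter> D = {}" using QA by simp_all
  have max: "J = Q" if "ideal J R" "I \<subseteq> J" "J \<inter> D = {}" "Q \<subseteq> J" for J
    using QJ that by simp
  have "\<exists>q\<in>Q. \<exists>f\<in>carrier R. q \<oplus> f \<otimes> c \<in> D" if c: "c \<in> carrier R" "c \<notin> Q" for c
  proof -
    let ?J = "Q <+>\<^bsub>R\<^esub> PIdl c"
    have J: "ideal ?J R" by (rule add_ideals[OF Q(1) cgenideal_ideal[OF c(1)]])
    have mem: "u \<in> ?J \<longleftrightarrow> (\<exists>q\<in>Q. \<exists>f\<in>carrier R. u = q \<oplus> f \<otimes> c)" for u
      unfolding set_add_def' cgenideal_def by blast
    have "Q \<subseteq> ?J"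
    proof
      fix q assume "q \<in> Q"
      moreover from this have "q = q \<oplus> \<zero> \<otimes> c" using c(1) ideal.Icarr[OF Q(1)] by simp
      ultimately show "q \<in> ?J" unfolding mem by blast
    qed
    moreover have "c \<in> ?J"
    proof -
      have "c = \<zero> \<oplus> \<one> \<otimes> c" using c(1) by simp
      then show ?thesis
        unfolding mem using additive_subgroup.zero_closed[OF ideal.axioms(1)[OF Q(1)]] by blast
    qed
    \<comment> \<open>If \<open>Q + (c)\<close> avoided \<open>D\<close>, maximality would make it
      equal to \<open>Q\<close>, although it contains \<open>c\<close>.\<close>
    ultimately have "?J \<inter> D \<noteq> {}" using max[OF J subset_trans[OF Q(2)]] c(2) by metis
    then obtain u where u: "u \<in> ?J" "u \<in> D" by blast
    from u(1)[unfolded mem] show ?thesis using u(2) by auto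
  qed
  with Q show ?thesis by (rule that)
qed

text \<open>This replaces an intersection over primes by the existence of one polynomial value in
  \<open>I\<close>, a condition that passes through fractions.\<close>

lemma special_radical_iff:
  assumes "field k" "algebra k A" "ideal I A" "b \<in> carrier A"
  shows "b \<in> special_radical k A I \<longleftrightarrow> signature_values k A b \<inter> I \<noteq> {}"
proof
  interpret A: algebra k A by fact
  assume "signature_values k A b \<inter> I \<noteq> {}"
  then obtain r where r: "r \<in> signature_values k A b" "r \<in> I" by blast
  from r(1) obtain e d x where e: "signature_pexp k e (Suc d)" "x \<in> UNIV \<rightarrow> carrier A" "x 0 = b"
    "r = pval A e x" by (rule signature_valuesE)
  have "b \<in> Q" if "special_ideal k A Q" "I \<subseteq> Q" for Q
    using that e r(2) unfolding special_ideal_iff_pexp[OF assms(1,2)] by blast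
  then show "b \<in> special_radical k A I"
    using assms(4) unfolding special_radical_def by blast
next
  interpret A: algebra k A by fact
  let ?D = "signature_values k A b"
  show "?D \<inter> I \<noteq> {}" if b: "b \<in> special_radical k A I"
  proof
    assume "?D \<inter> I = {}"
    then obtain Q where Q: "ideal Q A" "I \<subseteq> Q" "Q \<inter> ?D = {}"
      and max: "\<And>c. c \<in> carrier A \<Longrightarrow> c \<notin> Q \<Longrightarrow>
        \<exists>q\<in>Q. \<exists>f\<in>carrier A. q \<oplus>\<^bsub>A\<^esub> f \<otimes>\<^bsub>A\<^esub> c \<in> ?D"
      using A.ideal_maximal_avoiding[OF assms(3), of ?D] by (metis inf_commute)
    interpret Q: ideal Q A by fact
    have bQ: "b \<notin> Q" using signature_values_self[OF assms(4), of k] Q(3) by blast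
    have prime: "primeideal Q A"
    proof (rule primeidealI)
      show "carrier A \<noteq> Q" using bQ assms(4) by blast
      fix u v assume uv: "u \<in> carrier A" "v \<in> carrier A" "u \<otimes>\<^bsub>A\<^esub> v \<in> Q"
      show "u \<in> Q \<or> v \<in> Q"
      proof (rule ccontr)
        assume "\<not> (u \<in> Q \<or> v \<in> Q)"
        then obtain p f q g where p: "p \<in> Q" "f \<in> carrier A" "p \<oplus>\<^bsub>A\<^esub> f \<otimes>\<^bsub>A\<^esub> u \<in> ?D"
          and q: "q \<in> Q" "g \<in> carrier A" "q \<oplus>\<^bsub>A\<^esub> g \<otimes>\<^bsub>A\<^esub> v \<in> ?D"
          using max uv by meson
        note c = uv(1,2) p(1,2) q(1,2) p(1)[THEN Q.Icarr] q(1)[THEN Q.Icarr]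
        \<comment> \<open>Each term of the expanded product contains \<open>p\<close>,
          \<open>q\<close> or \<open>u v\<close>, all of which lie in \<open>Q\<close>.\<close>
        have "(p \<oplus>\<^bsub>A\<^esub> f \<otimes>\<^bsub>A\<^esub> u) \<otimes>\<^bsub>A\<^esub> (q \<oplus>\<^bsub>A\<^esub> g \<otimes>\<^bsub>A\<^esub> v) =
          p \<otimes>\<^bsub>A\<^esub> (q \<oplus>\<^bsub>A\<^esub> g \<otimes>\<^bsub>A\<^esub> v) \<oplus>\<^bsub>A\<^esub> ((f \<otimes>\<^bsub>A\<^esub> u) \<otimes>\<^bsub>A\<^esub> q \<oplus>\<^bsub>A\<^esub> (f \<otimes>\<^bsub>A\<^esub> g) \<otimes>\<^bsub>A\<^esub> (u \<otimes>\<^bsub>A\<^esub> v))"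
          using c by (simp add: A.l_distr A.r_distr A.m_ac A.M.a_ac)
        also have "\<dots> \<in> Q"
        proof (intro Q.a_closed)
          show "p \<otimes>\<^bsub>A\<^esub> (q \<oplus>\<^bsub>A\<^esub> g \<otimes>\<^bsub>A\<^esub> v) \<in> Q" using c by (intro Q.I_r_closed) auto
          show "(f \<otimes>\<^bsub>A\<^esub> u) \<otimes>\<^bsub>A\<^esub> q \<in> Q" using c by (intro Q.I_l_closed) auto
          show "(f \<otimes>\<^bsub>A\<^esub> g) \<otimes>\<^bsub>A\<^esub> (u \<otimes>\<^bsub>A\<^esub> v) \<in> Q" using c by (intro Q.I_l_closed[OF uv(3)]) auto
        qed
        finally show False
          using signature_values_mult[OF assms(1) p(3) q(3)] Q(3) by blast
      qed
    qed (use Q A.M_cring in auto)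
    have "x 0 \<in> Q" if x: "x \<in> UNIV \<rightarrow> carrier A" and e: "signature_pexp k e d" and v: "pval A e x \<in> Q" for e d x
    proof (rule ccontr)
      assume nQ: "x 0 \<notin> Q"
      have x0: "x 0 \<in> carrier A" using x by auto
      obtain q f where q: "q \<in> Q" "f \<in> carrier A" "q \<oplus>\<^bsub>A\<^esub> f \<otimes>\<^bsub>A\<^esub> x 0 \<in> ?D"
        using max[OF x0 nQ] by blast
      let ?r = "q \<oplus>\<^bsub>A\<^esub> f \<otimes>\<^bsub>A\<^esub> x 0"
      let ?y = "\<lambda>i. f \<otimes>\<^bsub>A\<^esub> x i"
      \<comment> \<open>Replacing the \<open>Y\<close> coordinate of the scaled point by
        \<open>?r\<close> changes it by \<open>q\<close> only, and now \<open>Y\<close> takes a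
        value from \<open>?D\<close>.\<close>
      let ?z = "?y(0 := ?r)"
      note qc = Q.Icarr[OF q(1)]
      have he: "homog_pexp k e d" by (rule signature_pexpD(1)[OF e])
      have y: "?y \<in> UNIV \<rightarrow> carrier A" using x q by auto
      have z: "?z \<in> UNIV \<rightarrow> carrier A" using x q(2) qc by (auto simp: Pi_def)
      have "?z i \<ominus>\<^bsub>A\<^esub> ?y i \<in> Q" for i
      proof (cases "i = 0")
        case True
        have "?r \<ominus>\<^bsub>A\<^esub> f \<otimes>\<^bsub>A\<^esub> x 0 = q"
          using q x0 qc by (simp add: a_minus_def A.M.a_assoc A.M.r_neg)
        then show ?thesis using True q(1) by simp
      next
        case False
        have "x i \<in> carrier A" using x by auto
        then show ?thesis using False q(2) by (simp add: a_minus_def A.M.r_neg)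
      qed
      then have "pval A e ?z \<ominus>\<^bsub>A\<^esub> pval A e ?y \<in> Q"
        by (rule A.pval_diff_in_ideal[OF Q(1) he z y])
      moreover have "pval A e ?y \<in> Q"
        unfolding A.pval_scale[OF he x q(2)] using v q(2) by (simp add: Q.I_l_closed)
      ultimately have "(pval A e ?z \<ominus>\<^bsub>A\<^esub> pval A e ?y) \<oplus>\<^bsub>A\<^esub> pval A e ?y \<in> Q" by (rule Q.a_closed)
      moreover have "pval A e ?z \<in> carrier A" "pval A e ?y \<in> carrier A"
        using A.pval_closed[OF he] y z by blast+
      ultimately have zQ: "pval A e ?z \<in> Q"
        by (simp add: a_minus_def A.M.a_assoc A.M.l_neg)
      \<comment> \<open>The degree \<open>d\<close> may be 0; the factor \<open>Y\<close> makes it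
        positive, so that composition with the certificate of \<open>?r\<close> is
        available.\<close>
      let ?e = "Mul (Var 0) e"
      have "signature_pexp k ?e (Suc d)"
        by (rule signature_pexp_mult_Var[OF assms(1) e])
      then have "pval A ?e ?z \<in> ?D"
        by (rule signature_values_compose[OF assms(1,2) q(3) _ z]) simp
      moreover have "pval A ?e ?z \<in> Q"
        using zQ z q x0 qc by (simp add: Q.I_l_closed)
      ultimately show False using Q(3) by blast
    qed
    then have "special_ideal k A Q"
      using Q(1) unfolding special_ideal_iff_pexp[OF assms(1,2)] by blast
    then have "b \<in> Q"
      using b prime Q(2) unfolding special_radical_def by blast
    then show False using bQ by simp
  qed
qed

section \<open>Localization\<close>

context algebra_localization
begin

text \<open>All coordinates have the same denominator \<open>s\<close>, so a homogeneous expression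
  of degree \<open>d\<close> has the denominator \<open>s\<close> to the power
  \<open>d\<close>.\<close>

lemma pval_loc_frac:
  assumes "homog_pexp R e d" "x \<in> UNIV \<rightarrow> carrier A" "s \<in> S"
  shows "pval (localization A S) e (\<lambda>i. loc_frac A S (x i) s) = loc_frac A S (pval A e x) (s [^]\<^bsub>A\<^esub> d)"
proof -
  have pow: "s [^]\<^bsub>A\<^esub> n \<in> S" for n :: nat
    using assms(3) by (induction n) auto
  show ?thesis
    using assms(1)
  proof (induction e arbitrary: d)
    case (Con c)
    have "pval (localization A S) (Con c) (\<lambda>i. loc_frac A S (x i) s) = loc_frac A S (c \<odot>\<^bsub>A\<^esub> \<one>\<^bsub>A\<^esub>) \<one>\<^bsub>A\<^esub>"
      using Con by (simp add: loc_one loc_smult_frac)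
    \<comment> \<open>Either \<open>d = 0\<close> and the denominators agree, or \<open>c\<close> is
      zero and every denominator is allowed.\<close>
    also have "\<dots> = loc_frac A S (c \<odot>\<^bsub>A\<^esub> \<one>\<^bsub>A\<^esub>) (s [^]\<^bsub>A\<^esub> d)"
      using Con pow[of d] by (intro loc_frac_eqI1) (auto simp: S_carrier)
    finally show ?case by simp
  next
    case (Var i)
    then show ?case using S_carrier[OF assms(3)] by simp
  next
    case (Add e f)
    then have cl: "pval A e x \<in> carrier A" "pval A f x \<in> carrier A" using assms(2) by auto
    \<comment> \<open>Adding fractions doubles the exponent of the denominator; one factor
      \<open>s\<close> to the power \<open>d\<close> cancels.\<close>
    then have "loc_frac A S (s [^]\<^bsub>A\<^esub> d \<otimes>\<^bsub>A\<^esub> pval A e x \<oplus>\<^bsub>A\<^esub> s [^]\<^bsub>A\<^esub> d \<otimes>\<^bsub>A\<^esub> pval A f x) (s [^]\<^bsub>A\<^esub> d \<otimes>\<^bsub>A\<^esub> s [^]\<^bsub>A\<^esub> d) =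
        loc_frac A S (pval A e x \<oplus>\<^bsub>A\<^esub> pval A f x) (s [^]\<^bsub>A\<^esub> d)"
      using pow[of d] S_carrier[OF pow[of d]] by (intro loc_frac_eqI1) (simp_all add: r_distr m_ac)
    then show ?case using Add.IH[of d] Add.prems cl pow by (simp add: loc_add_frac)
  next
    case (Mul e f)
    then obtain p q where d: "d = p + q" "homog_pexp R e p" "homog_pexp R f q" by auto
    then have "pval A e x \<in> carrier A" "pval A f x \<in> carrier A" using assms(2) by auto
    then show ?case
      using Mul.IH(1)[OF d(2)] Mul.IH(2)[OF d(3)] d(1) pow S_carrier[OF assms(3)] by (simp add: loc_mult_frac nat_pow_mult)
  qed
qed

text \<open>When a coordinate with denominator \<open>t\<close> joins, the old numerators are
  multiplied by \<open>t\<close>, the new one by \<open>s\<close>, and the denominator becomes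
  \<open>s t\<close>.\<close>

lemma common_denominator:
  assumes "finite V" "\<And>i. i \<in> V \<Longrightarrow> y i \<in> carrier (localization A S)"
  obtains x s where "x \<in> UNIV \<rightarrow> carrier A" "s \<in> S" "\<And>i. i \<in> V \<Longrightarrow> y i = loc_frac A S (x i) s"
proof -
  have "\<exists>x s. x \<in> UNIV \<rightarrow> carrier A \<and> s \<in> S \<and> (\<forall>i\<in>V. y i = loc_frac A S (x i) s)"
    using assms
  proof (induction V)
    case empty
    then show ?case by (intro exI[of _ "\<lambda>_. \<zero>\<^bsub>A\<^esub>"] exI[of _ "\<one>\<^bsub>A\<^esub>"]) auto
  next
    case (insert j V)
    then obtain x s where x: "x \<in> UNIV \<rightarrow> carrier A" "s \<in> S" "\<forall>i\<in>V. y i = loc_frac A S (x i) s" by auto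
    obtain a t where a: "a \<in> carrier A" "t \<in> S" "y j = loc_frac A S a t"
      using insert.prems[of j] by (auto elim: loc_cases)
    note c = x(2) a(2) x(2)[THEN S_carrier] a(2)[THEN S_carrier]
    let ?x = "\<lambda>i. if i = j then s \<otimes>\<^bsub>A\<^esub> a else t \<otimes>\<^bsub>A\<^esub> x i"
    have "y i = loc_frac A S (?x i) (s \<otimes>\<^bsub>A\<^esub> t)" if "i \<in> insert j V" for i
    proof (cases "i = j")
      case True
      have "loc_frac A S a t = loc_frac A S (s \<otimes>\<^bsub>A\<^esub> a) (s \<otimes>\<^bsub>A\<^esub> t)"
        using c a(1) by (intro loc_frac_eqI1) (auto simp: m_ac)
      then show ?thesis using True a(3) by simp
    next
      case False
      have "x i \<in> carrier A" using x(1) by auto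
      then have "loc_frac A S (x i) s = loc_frac A S (t \<otimes>\<^bsub>A\<^esub> x i) (s \<otimes>\<^bsub>A\<^esub> t)"
        using c by (intro loc_frac_eqI1) (auto simp: m_ac)
      then show ?thesis using False x(3) that by simp
    qed
    moreover have "?x \<in> UNIV \<rightarrow> carrier A" using x(1) a(1) c by (auto simp: Pi_def)
    moreover have "s \<otimes>\<^bsub>A\<^esub> t \<in> S" using c by simp
    ultimately show ?case by blast
  qed
  then show ?thesis using that by blast
qed

text \<open>The numerator itself may lie outside \<open>J\<close>: membership only provides an equal
  fraction with numerator in \<open>J\<close>, and equality of fractions costs a factor from
  \<open>S\<close>.\<close>

lemma loc_frac_in_loc_idealD:
  assumes "ideal J A" "a \<in> carrier A" "s \<in> S" "loc_frac A S a s \<in> loc_ideal A S J"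
  obtains w where "w \<in> S" "w \<otimes>\<^bsub>A\<^esub> a \<in> J"
proof -
  interpret J: ideal J A by fact
  obtain c t where c: "c \<in> J" "t \<in> S" "loc_frac A S a s = loc_frac A S c t"
    using assms(4) by (rule loc_idealE)
  obtain u where u: "u \<in> S" "u \<otimes>\<^bsub>A\<^esub> (t \<otimes>\<^bsub>A\<^esub> a) = u \<otimes>\<^bsub>A\<^esub> (s \<otimes>\<^bsub>A\<^esub> c)"
    using c loc_frac_eq_iff[OF assms(2,3) J.Icarr[OF c(1)] c(2)] by auto
  have "(u \<otimes>\<^bsub>A\<^esub> t) \<otimes>\<^bsub>A\<^esub> a = (u \<otimes>\<^bsub>A\<^esub> s) \<otimes>\<^bsub>A\<^esub> c"
    using u c J.Icarr[OF c(1)] assms(2,3) by (simp add: m_assoc S_carrier)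
  moreover have "(u \<otimes>\<^bsub>A\<^esub> s) \<otimes>\<^bsub>A\<^esub> c \<in> J"
    using u c assms(3) by (intro J.I_l_closed) (auto simp: S_carrier)
  ultimately show ?thesis using that[of "u \<otimes>\<^bsub>A\<^esub> t"] u c by simp
qed

end

theorem lemma5p7:
  fixes k :: "('k, 'r) ring_scheme" and A :: "('k, 'a, 'm) module_scheme"
    and I S :: "'a set"
  assumes "field k" and "algebra k A" and "ideal I A" and "submonoid S A"
  shows "loc_ideal A S (special_radical k A I) =
    special_radical k (localization A S) (loc_ideal A S I)"
proof -
  interpret algebra_localization k A S
    using assms(2,4) by (rule algebra_localization.intro)
  interpret I: ideal I A by fact
  \<comment> \<open>Both radicals are replaced by the existence of certificates.\<close>
  note rad = special_radical_iff[OF assms(1-3)]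
  note loc_rad = special_radical_iff[OF assms(1) loc_algebra loc_ideal_ideal[OF assms(3)]]
  have pow: "s [^]\<^bsub>A\<^esub> n \<in> S" if "s \<in> S" for s and n :: nat
    using that by (induction n) auto
  show ?thesis
  proof (intro equalityI subsetI)
    fix U assume "U \<in> loc_ideal A S (special_radical k A I)"
    then obtain a s where a: "a \<in> special_radical k A I" "s \<in> S" and U: "U = loc_frac A S a s"
      by (rule loc_idealE)
    have "a \<in> carrier A" using a(1) by (simp add: special_radical_def)
    then obtain r where r: "r \<in> signature_values k A a" "r \<in> I" using rad a(1) by blast
    from r(1) obtain e d x where e: "signature_pexp k e (Suc d)"
      and x: "x \<in> UNIV \<rightarrow> carrier A" "x 0 = a" and v: "r = pval A e x" by (rule signature_valuesE)
    \<comment> \<open>Dividing the point by \<open>s\<close> turns a certificate for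
      \<open>a\<close> into one for \<open>a / s\<close>; its value is \<open>r\<close> over a power
      of \<open>s\<close>.\<close>
    let ?y = "\<lambda>i. loc_frac A S (x i) s"
    have "pval (localization A S) e ?y \<in> loc_ideal A S I"
      unfolding pval_loc_frac[OF signature_pexpD(1)[OF e] x(1) a(2)]
      using r(2)[unfolded v] pow[OF a(2)] by (rule loc_idealI)
    moreover have "?y \<in> UNIV \<rightarrow> carrier (localization A S)" using x a(2) by auto
    then have "pval (localization A S) e ?y \<in> signature_values k (localization A S) U"
      using x(2) U by (intro signature_valuesI[OF e]) auto
    moreover have "U \<in> carrier (localization A S)"
      using U a(2) \<open>a \<in> carrier A\<close> by simp
    ultimately show "U \<in> special_radical k (localization A S) (loc_ideal A S I)"
      using loc_rad by blast
  next
    fix U assume U: "U \<in> special_radical k (localization A S) (loc_ideal A S I)"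
    then have "U \<in> carrier (localization A S)" by (simp add: special_radical_def)
    then obtain r where r: "r \<in> signature_values k (localization A S) U" "r \<in> loc_ideal A S I"
      using loc_rad U by blast
    from r(1) obtain e d y where e: "signature_pexp k e (Suc d)"
      and y: "y \<in> UNIV \<rightarrow> carrier (localization A S)" "y 0 = U"
      and v: "r = pval (localization A S) e y"
      by (rule signature_valuesE)
    have yc: "y i \<in> carrier (localization A S)" for i using y(1) by auto
    \<comment> \<open>Index 0 is included even if \<open>Y\<close> does not occur in
      \<open>e\<close>, because \<open>U = y 0\<close> must be written over the common denominator
      too.\<close>
    have fin: "finite (insert 0 (pexp_vars e))" by simp
    obtain x t where x: "x \<in> UNIV \<rightarrow> carrier A" "t \<in> S"
      and yx: "\<And>i. i \<in> insert 0 (pexp_vars e) \<Longrightarrow> y i = loc_frac A S (x i) t"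
      by (rule common_denominator[where y = y, OF fin yc]) auto
    note he = signature_pexpD(1)[OF e]
    have ex: "pval A e x \<in> carrier A" using he x(1) by blast
    have "pval (localization A S) e y = pval (localization A S) e (\<lambda>i. loc_frac A S (x i) t)"
      by (rule pval_cong) (use yx in auto)
    also have "\<dots> = loc_frac A S (pval A e x) (t [^]\<^bsub>A\<^esub> Suc d)"
      by (rule pval_loc_frac[OF he x])
    finally obtain w where w: "w \<in> S" "w \<otimes>\<^bsub>A\<^esub> pval A e x \<in> I"
      using loc_frac_in_loc_idealD[OF assms(3) ex pow[OF x(2)]] r(2) v by metis
    note wA = S_carrier[OF w(1)]
    \<comment> \<open>The positive degree is used here: of the \<open>Suc d\<close> factors
      \<open>w\<close>, one is spent on bringing the value into \<open>I\<close>.\<close>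
    have "pval A e (\<lambda>i. w \<otimes>\<^bsub>A\<^esub> x i) = w [^]\<^bsub>A\<^esub> d \<otimes>\<^bsub>A\<^esub> (w \<otimes>\<^bsub>A\<^esub> pval A e x)"
      using pval_scale[OF he x(1) wA] wA ex by (simp add: m_assoc)
    also have "\<dots> \<in> I" using wA by (intro I.I_l_closed[OF w(2)]) auto
    finally have "pval A e (\<lambda>i. w \<otimes>\<^bsub>A\<^esub> x i) \<in> I" .
    moreover have "(\<lambda>i. w \<otimes>\<^bsub>A\<^esub> x i) \<in> UNIV \<rightarrow> carrier A" using wA x(1) by auto
    then have "pval A e (\<lambda>i. w \<otimes>\<^bsub>A\<^esub> x i) \<in> signature_values k A (w \<otimes>\<^bsub>A\<^esub> x 0)"
      by (intro signature_valuesI[OF e]) auto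
    moreover have x0: "x 0 \<in> carrier A" using x(1) by auto
    ultimately have "w \<otimes>\<^bsub>A\<^esub> x 0 \<in> special_radical k A I"
      using rad[of "w \<otimes>\<^bsub>A\<^esub> x 0"] wA by blast
    then have "loc_frac A S (w \<otimes>\<^bsub>A\<^esub> x 0) (w \<otimes>\<^bsub>A\<^esub> t) \<in> loc_ideal A S (special_radical k A I)"
      using w x(2) by (intro loc_idealI) auto
    \<comment> \<open>The certificate is for \<open>w x 0\<close>, not for \<open>x 0\<close>;
      putting \<open>w\<close> into the denominator as well recovers \<open>U\<close>.\<close>
    also have "loc_frac A S (w \<otimes>\<^bsub>A\<^esub> x 0) (w \<otimes>\<^bsub>A\<^esub> t) = loc_frac A S (x 0) t"
      using w wA x(2) S_carrier[OF x(2)] x0 by (intro loc_frac_eqI1) (auto simp: m_ac)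
    also have "\<dots> = U" using yx[of 0] y(2) by simp
    finally show "U \<in> loc_ideal A S (special_radical k A I)" .
  qed
qed

end
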